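(* Let $A\in\mathbb C$ be given, with $\mathrm e^A\neq-1$. For every odd $n$, set $q=\mathrm e^{\frac{2\pi\mathrm i}n}$ and $u=q\,\mathrm e^{-\frac1nA}$. Then $$\lim_{\substack{n\to\infty\\ n\equiv1\bmod4}}\left|D^q(u)\right|^{\frac1n}=2^{-\frac{\operatorname{Im}A}{4\pi}}\left|\frac{\cosh\frac{A-\pi\mathrm i}4}{\cosh\frac{A+\pi\mathrm i}4}\right|^{\frac14},$$ $$\lim_{\substack{n\to\infty\\ n\equiv3\bmod4}}\left|D^q(u)\right|^{\frac1n}=2^{-\frac{\operatorname{Im}A}{4\pi}}\left|\frac{\sinh\frac{A-\pi\mathrm i}4}{\sinh\frac{A+\pi\mathrm i}4}\right|^{\frac14}.$$
   Context: For $n$ odd, $q$ a primitive $n$-th root of unity and $u\in\mathbb C$ with $u^n\neq-1$, $$D^q(u)=(1+u^n)^{-\frac{n+1}2}\prod_{j=1}^n(1+uq^{-2j})^{n-j+1}.$$ *)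

theory Defs
  imports "HOL-Analysis.Analysis"
begin

text \<open>
  The order \<open>n\<close> of the root of unity \<open>q\<close> is passed as an explicit argument. The intended domain is:
  \<open>n\<close> odd, \<open>q\<close> a primitive \<open>n\<close>-th root of unity and \<open>u ^ n \<noteq> -1\<close>; there
  the division in the first exponent is exact, and no branch of a complex power is involved.
\<close>

definition Dq :: "nat \<Rightarrow> complex \<Rightarrow> complex \<Rightarrow> complex" where
  "Dq n q u =
     (1 + u ^ n) powi (- ((int n + 1) div 2)) *
     (\<Prod>j=1..n. (1 + u * q powi (- 2 * int j)) ^ (n - j + 1))"

text \<open>The filter for limits along \<open>n \<longrightarrow> \<infinity>\<close> with \<open>n\<close> restricted to a residue class.\<close>

definition sequentially_mod :: "nat \<Rightarrow> nat \<Rightarrow> nat filter" where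
  "sequentially_mod r m = inf sequentially (principal {n. n mod m = r mod m})"

end

theory Submission
  imports Defs "HOL-Complex_Analysis.Complex_Analysis" "HOL-Real_Asymp.Real_Asymp"
begin

text \<open>
  Since \<open>\<Prod>j=1..n. 1 + u q\<^bsup>-2j\<^esup>\<close> equals \<open>1 + u\<^sup>n\<close>, the prefactor of \<open>D\<close> symmetrises the exponents to
  \<open>m = (n + 1) / 2 - j\<close>. Pairing \<open>m\<close> with \<open>-m\<close> and centring at the singularity
  \<open>m = n / 4 + s\<close>, where \<open>s = k \<plusminus> 1 / 4\<close> with \<open>-p \<le> k \<le> p\<close>, gives
  \<open>(ln \<bar>D\<bar>) / n = (\<Sum>k. (1 / 4 + s / n) (ln \<bar>sinh (iy - a)\<bar> - ln \<bar>sinh (iy + a)\<bar>))\<close>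
  with \<open>y = 2 \<pi> s / n\<close> and \<open>a = A / (2 n)\<close>.

  Splitting \<open>sinh z\<close> as \<open>(sinh z / z) \<cdot> z\<close> separates a regular from a singular part. The logarithm of the
  regular factor is expanded to first order in \<open>a\<close>, which leaves a Riemann sum whose integral reduces to
  that of \<open>ln (sin y / y)\<close> over \<open>[-\<pi> / 2, \<pi> / 2]\<close>. The singular factor contributes the logarithm of a
  quotient of partial sine products, weighted by \<open>1 / 4\<close>, and a Cesaro mean of
  \<open>s (ln \<bar>s + w\<bar> - ln \<bar>s - w\<bar>) \<longlonglongrightarrow> 2 Re w\<close> with \<open>w = i A / (4 \<pi>)\<close>.
\<close>

subsection \<open>Sums over symmetric ranges\<close>

lemma sum_int_symmetric:
  fixes f :: "int \<Rightarrow> 'a::comm_monoid_add"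
  shows "(\<Sum>k=-int p..int p. f k) = f 0 + (\<Sum>k=1..p. f (int k) + f (- int k))"
proof (induction p)
  case (Suc p)
  have "{-int (Suc p)..int (Suc p)} =
      insert (int (Suc p)) (insert (- int (Suc p)) {-int p..int p})"
    by auto
  with Suc show ?case
    by (simp add: ac_simps)
qed auto

lemma Cesaro_mean_tendsto:
  fixes g :: "nat \<Rightarrow> real"
  assumes "g \<longlonglongrightarrow> l"
  shows "(\<lambda>p. (\<Sum>k=1..p. g k) / real p) \<longlonglongrightarrow> l"
proof (rule LIMSEQ_I)
  fix e :: real assume e: "e > 0"
  obtain N where N: "\<And>k. k \<ge> N \<Longrightarrow> \<bar>g k - l\<bar> < e / 2"
    using LIMSEQ_D[OF assms, of "e / 2"] e by auto
  define C where "C = (\<Sum>k=1..N. \<bar>g k - l\<bar>)"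
  have bound: "\<bar>\<Sum>k=1..p. g k - l\<bar> \<le> C + real p * (e / 2)" for p
  proof -
    have "\<bar>\<Sum>k=1..p. g k - l\<bar> \<le> (\<Sum>k=1..p. \<bar>g k - l\<bar>)"
      by (rule sum_abs)
    also have "\<dots> \<le> (\<Sum>k=1..p. (if k \<in> {1..N} then \<bar>g k - l\<bar> else 0) + e / 2)"
      using N e by (intro sum_mono) (auto intro: less_imp_le)
    also have "\<dots> = (\<Sum>k\<in>{1..p} \<inter> {1..N}. \<bar>g k - l\<bar>) + real p * (e / 2)"
      by (simp add: sum.distrib sum.inter_restrict[symmetric] del: atLeastAtMost_iff Int_atLeastAtMost)
    also have "(\<Sum>k\<in>{1..p} \<inter> {1..N}. \<bar>g k - l\<bar>) \<le> C"
      unfolding C_def by (intro sum_mono2) auto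
    finally show ?thesis by simp
  qed
  obtain M :: nat where M: "2 * C / e < real M"
    using reals_Archimedean2 by blast
  have "norm ((\<Sum>k=1..p. g k) / real p - l) < e" if p: "p \<ge> Suc M" for p
  proof -
    have "2 * C / e < real p" "real p > 0"
      using M p by linarith+
    hence "C < real p * (e / 2)" using e by (simp add: field_simps)
    hence "\<bar>\<Sum>k=1..p. g k - l\<bar> < real p * e"
      using bound[of p] by linarith
    moreover have "(\<Sum>k=1..p. g k) / real p - l = (\<Sum>k=1..p. g k - l) / real p"
      using p by (simp add: sum_subtractf field_simps)
    ultimately show ?thesis
      using \<open>real p > 0\<close> by (simp add: field_simps)
  qed
  thus "\<exists>M. \<forall>p\<ge>M. norm ((\<Sum>k=1..p. g k) / real p - l) < e" by blast
qed

text \<open>Each term is compared with the increment of \<open>F\<close> over the cell of width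
  \<open>1 / n\<close> centred at \<open>k / n\<close>. By the mean value theorem this increment is
  \<open>f z / n\<close> with \<open>z\<close> in the cell; the sample point lies in the same cell
  because |\<delta>| \<le> 1/2, and \<open>f\<close> is uniformly continuous. The increments
  telescope, with end points tending to \<open>r\<close> and \<open>- r\<close>; the margin up to
  \<open>c\<close> keeps the cells where \<open>F\<close> is known for large
  \<open>p\<close>.\<close>

lemma Riemann_sum_symmetric:
  fixes f F :: "real \<Rightarrow> real" and n :: "nat \<Rightarrow> real"
  assumes r: "0 < r" "r < c"
    and F: "\<And>x. \<bar>x\<bar> \<le> c \<Longrightarrow> (F has_real_derivative f x) (at x)"
    and f: "continuous_on {-c..c} f"
    and \<delta>: "\<bar>\<delta>\<bar> \<le> 1 / 2"
    and n: "filterlim n at_top sequentially" "(\<lambda>p. (real p + 1 / 2) / n p) \<longlonglongrightarrow> r"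
  shows "(\<lambda>p. (\<Sum>k=-int p..int p. f ((of_int k + \<delta>) / n p)) / n p) \<longlonglongrightarrow> F r - F (- r)"
proof -
  define c' where "c' = (\<lambda>p. (real p + 1 / 2) / n p)"
  define cell where
    "cell = (\<lambda>p k. F ((of_int k + 1 / 2) / n p) - F ((of_int k - 1 / 2) / n p))"
  have tele: "(\<Sum>k=-int p..int p. cell p k) = F (c' p) - F (- c' p)" for p
  proof -
    have aux: "(\<Sum>k=-int p..int p. G (of_int k + 1 / 2) - G (of_int k - 1 / 2))
        = G (real p + 1 / 2) - G (- real p - 1 / 2)" for G :: "real \<Rightarrow> real"
    proof (induction p)
      case (Suc p)
      have "{-int (Suc p)..int (Suc p)} =
          insert (int (Suc p)) (insert (- int (Suc p)) {-int p..int p})"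
        by auto
      moreover have "G (- (1 / 2) - real p) = G (- real p - 1 / 2)"
        by (rule arg_cong[where f = G]) simp
      ultimately show ?case using Suc by (simp add: algebra_simps)
    qed auto
    have "- c' p = (- real p - 1 / 2) / n p"
      by (simp add: c'_def diff_divide_distrib add_divide_distrib)
    with aux[of "\<lambda>x. F (x / n p)"] show ?thesis
      by (simp add: cell_def c'_def)
  qed
  have F_isCont: "isCont F x" if "\<bar>x\<bar> \<le> c" for x
    using F[OF that] by (rule DERIV_isCont)
  have lim_tele: "(\<lambda>p. \<Sum>k=-int p..int p. cell p k) \<longlonglongrightarrow> F r - F (- r)"
    unfolding tele using n(2) r
    by (intro tendsto_diff isCont_tendsto_compose[of _ F] F_isCont tendsto_minus)
       (auto simp: c'_def)
  have diff: "(\<lambda>p. (\<Sum>k=-int p..int p. f ((of_int k + \<delta>) / n p)) / n p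
      - (\<Sum>k=-int p..int p. cell p k)) \<longlonglongrightarrow> 0"
  proof (rule tendstoI)
    fix e :: real assume e: "e > 0"
    \<comment> \<open>The \<open>2 p + 1\<close> cells contribute at most \<open>e' / n\<close>
      each, in total less than \<open>2 e' c = e / 2\<close>.\<close>
    define e' where "e' = e / (4 * c)"
    have e': "e' > 0" using e r by (simp add: e'_def)
    have "uniformly_continuous_on {-c..c} f"
      using f by (intro compact_uniformly_continuous) auto
    then obtain d where d: "d > 0"
      "\<And>x y. x \<in> {-c..c} \<Longrightarrow> y \<in> {-c..c} \<Longrightarrow> dist y x < d \<Longrightarrow> dist (f y) (f x) < e'"
      unfolding uniformly_continuous_on_def using e' by metis
    have ev: "\<forall>\<^sub>F p in sequentially. n p > 1 / d"
      "\<forall>\<^sub>F p in sequentially. n p > 0" "\<forall>\<^sub>F p in sequentially. c' p < c"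
      using n(1) order_tendstoD(2)[OF n(2) r(2)]
      by (auto simp: filterlim_at_top_dense c'_def)
    show "\<forall>\<^sub>F p in sequentially. dist ((\<Sum>k=-int p..int p. f ((of_int k + \<delta>) / n p)) / n p
      - (\<Sum>k=-int p..int p. cell p k)) 0 < e"
      using ev
    proof eventually_elim
      case (elim p)
      have np: "n p > 0" and nd: "1 / n p < d"
        using elim d(1) by (auto simp: field_simps)
      have step: "\<bar>f ((of_int k + \<delta>) / n p) / n p - cell p k\<bar> \<le> e' / n p"
        if k: "k \<in> {-int p..int p}" for k
      proof -
        define l h where "l = (of_int k - 1 / 2) / n p" and "h = (of_int k + 1 / 2) / n p"
        define x where "x = (of_int k + \<delta>) / n p"
        have lh: "l < h" "h - l = 1 / n p"
          using np by (auto simp: l_def h_def divide_simps)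
        have kk: "\<bar>of_int k\<bar> \<le> real p" using k by simp linarith
        have "h \<le> c' p" "- c' p \<le> l" "l \<le> x" "x \<le> h"
          unfolding h_def l_def c'_def x_def minus_divide_left using kk np \<delta>
          by (intro divide_right_mono; simp; linarith)+
        hence in_c: "- c \<le> l" "h \<le> c" "l \<le> x" "x \<le> h" using elim by auto
        obtain z where z: "l < z" "z < h" "F h - F l = (h - l) * f z"
          using MVT2[OF lh(1), of F f] F in_c by (metis abs_le_iff minus_le_iff order_trans)
        have "dist (f x) (f z) < e'"
          using in_c z lh nd by (intro d(2)) (auto simp: dist_real_def)
        hence "\<bar>f x - f z\<bar> / n p \<le> e' / n p"
          using np by (intro divide_right_mono) (auto simp: dist_real_def)
        moreover have "f x / n p - cell p k = (f x - f z) / n p"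
          using z(3) lh(2) by (simp add: cell_def l_def h_def diff_divide_distrib)
        ultimately show ?thesis
          using np by (simp add: x_def abs_divide)
      qed
      have "\<bar>(\<Sum>k=-int p..int p. f ((of_int k + \<delta>) / n p)) / n p - (\<Sum>k=-int p..int p. cell p k)\<bar>
          = \<bar>\<Sum>k=-int p..int p. f ((of_int k + \<delta>) / n p) / n p - cell p k\<bar>"
        by (simp add: sum_subtractf sum_divide_distrib)
      also have "\<dots> \<le> (\<Sum>k=-int p..int p. e' / n p)"
        using step by (intro order_trans[OF sum_abs sum_mono]) auto
      also have "\<dots> = 2 * e' * c' p"
        using np by (simp add: c'_def field_simps)
      also have "\<dots> < 2 * e' * c" using elim e' by simp
      also have "\<dots> < e" using e r by (simp add: e'_def)
      finally show ?case by (simp add: dist_real_def)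
    qed
  qed
  show ?thesis using tendsto_add[OF diff lim_tele] by simp
qed

subsection \<open>The logarithm of \<open>sinh z / z\<close>\<close>

text \<open>The zeros of \<open>sinh\<close> are the integer multiples of \<pi>i, and only 0 lies in
  this strip, so \<open>sinh z / z\<close> has a holomorphic logarithm on it.\<close>

definition strip :: "complex set" where
  "strip = {z. \<bar>Im z\<bar> < pi}"

lemma open_strip: "open strip" and convex_strip: "convex strip"
proof -
  have eq: "strip = {z. Im z < pi} \<inter> {z. Im z > - pi}"
    by (auto simp: strip_def)
  show "open strip" unfolding eq
    by (intro open_Int open_halfspace_Im_lt open_halfspace_Im_gt)
  show "convex strip" unfolding eq
    by (intro convex_Int convex_halfspace_Im_lt convex_halfspace_Im_gt)
qed

lemma sinh_eq_0_strip:
  assumes "z \<in> strip" "sinh z = 0"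
  shows "z = 0"
proof -
  have "exp z * exp z = 1"
    using assms(2) by (simp add: sinh_field_def exp_minus field_simps)
  hence "exp (z + z) = 1"
    by (simp only: exp_add)
  then obtain k :: int where k: "Re z = 0" "Im z = of_int k * pi"
    by (auto simp: exp_eq_1)
  hence "\<bar>of_int k :: real\<bar> * pi < 1 * pi"
    using assms(1) by (simp add: strip_def abs_mult)
  hence "k = 0" by (subst (asm) mult_less_cancel_right) auto
  thus ?thesis using k by (simp add: complex_eq_iff)
qed

text \<open>Filling the removable singularity at 0 with the value 1 gives a zero-free function on a
  convex, hence contractible, set; it is therefore \<open>exp L\<close>. Convexity also provides the
  primitive \<Phi>.\<close>

lemma strip_log_sinhc:
  obtains L L1 L2 \<Phi> :: "complex \<Rightarrow> complex"
  where "\<And>z. z \<in> strip \<Longrightarrow> Re (L z) = ln (norm (sinh z / z))"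
    and "\<And>z. z \<in> strip \<Longrightarrow> (L has_field_derivative L1 z) (at z)"
    and "\<And>z. z \<in> strip \<Longrightarrow> (L1 has_field_derivative L2 z) (at z)"
    and "continuous_on strip L2"
    and "\<And>z. z \<in> strip \<Longrightarrow> (\<Phi> has_field_derivative L z) (at z)"
proof -
  define S where "S = (\<lambda>z::complex. if z = 0 then deriv sinh 0 else (sinh z - sinh 0) / (z - 0))"
  have d: "deriv sinh (0::complex) = 1"
    by (rule DERIV_imp_deriv) (auto intro!: derivative_eq_intros)
  have "S holomorphic_on strip"
    unfolding S_def using open_strip
    by (intro pole_lemma_open)
      (auto simp: holomorphic_on_open intro!: derivative_eq_intros exI)
  moreover have "S z \<noteq> 0" if "z \<in> strip" for z
    using sinh_eq_0_strip[OF that] d by (auto simp: S_def)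
  ultimately obtain L where L: "L holomorphic_on strip" "\<And>z. z \<in> strip \<Longrightarrow> S z = exp (L z)"
    using contractible_imp_holomorphic_log[OF _ convex_imp_contractible[OF convex_strip]] by metis
  obtain \<Phi> where \<Phi>: "\<And>z. z \<in> strip \<Longrightarrow> (\<Phi> has_field_derivative L z) (at z within strip)"
    using holomorphic_convex_primitive'[OF convex_strip open_strip L(1)] by metis
  have hol1: "deriv L holomorphic_on strip" and hol2: "deriv (deriv L) holomorphic_on strip"
    using L(1) open_strip by (auto intro: holomorphic_deriv)
  show thesis
  proof (rule that[of L "deriv L" "deriv (deriv L)" \<Phi>])
    show "Re (L z) = ln (norm (sinh z / z))" if "z \<in> strip" for z
    proof (cases "z = 0")
      case True
      \<comment> \<open>At 0 the right side is \<open>ln 0 = 0\<close>, since division by zero gives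
        0; this agrees with \<open>Re (L 0) = 0\<close>.\<close>
      with L(2)[OF that] d have "exp (L 0) = 1" by (simp add: S_def)
      thus ?thesis using True by (simp add: exp_eq_1)
    next
      case False
      with L(2)[OF that] have "sinh z / z = exp (L z)" by (simp add: S_def)
      thus ?thesis by simp
    qed
    show "continuous_on strip (deriv (deriv L))"
      using hol2 by (rule holomorphic_on_imp_continuous_on)
    show "(\<Phi> has_field_derivative L z) (at z)" if "z \<in> strip" for z
      using \<Phi>[OF that] at_within_open[OF that open_strip] by simp
  qed (use L(1) hol1 open_strip in \<open>auto intro: holomorphic_derivI\<close>)
qed

text \<open>Going along the imaginary axis multiplies the derivative by \<open>i\<close>. This
  transfers facts about \<open>L\<close> and its primitive to \<open>ln (sin y / y)\<close>.\<close>

lemma DERIV_Re_imag_axis: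
  assumes "(f has_field_derivative f') (at (\<i> * of_real y))"
  shows "((\<lambda>y. Re (f (\<i> * of_real y))) has_real_derivative - Im f') (at y)"
    and "((\<lambda>y. Im (f (\<i> * of_real y))) has_real_derivative Re f') (at y)"
proof -
  have "((\<lambda>y. \<i> * of_real y) has_vector_derivative \<i>) (at y)"
    by (auto intro!: derivative_eq_intros)
  hence "((\<lambda>y. f (\<i> * of_real y)) has_vector_derivative \<i> * f') (at y)"
    using field_vector_diff_chain_at[of "\<lambda>y. \<i> * of_real y" \<i> y f f'] assms
    by (simp add: o_def)
  hence "((\<lambda>y. Re (f (\<i> * of_real y))) has_vector_derivative Re (\<i> * f')) (at y)"
    "((\<lambda>y. Im (f (\<i> * of_real y))) has_vector_derivative Im (\<i> * f')) (at y)"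
    by (auto simp: has_vector_derivative_complex_iff has_real_derivative_iff_has_vector_derivative)
  thus "((\<lambda>y. Re (f (\<i> * of_real y))) has_real_derivative - Im f') (at y)"
    "((\<lambda>y. Im (f (\<i> * of_real y))) has_real_derivative Re f') (at y)"
    by (simp_all add: has_real_derivative_iff_has_vector_derivative)
qed

text \<open>At \<open>y = 0\<close> the junk value \<open>ln (sin 0 / 0) = 0\<close> is the continuous extension.\<close>

lemma integral_ln_sinc:
  fixes \<Lambda> :: "real \<Rightarrow> real"
  assumes \<Lambda>: "\<And>y. \<bar>y\<bar> < pi \<Longrightarrow> (\<Lambda> has_real_derivative ln (sin y / y)) (at y)"
  shows "\<Lambda> (pi / 2) - \<Lambda> (- (pi / 2)) = pi * (1 - ln pi)"
proof -
  define l where "l = (\<lambda>y::real. ln (sin y / y))"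
  have l_even: "l (- y) = l y" for y
    by (simp add: l_def)
  have \<Lambda>: "(\<Lambda> has_real_derivative l y) (at y)" if "\<bar>y\<bar> < pi" for y
    using \<Lambda>[OF that] by (simp add: l_def)
  \<comment> \<open>The integrand is even, so this sum has derivative 0; it remains to work on
    \<open>[0, pi / 2]\<close>.\<close>
  have "\<Lambda> (pi / 2) + \<Lambda> (- (pi / 2)) = \<Lambda> 0 + \<Lambda> (- 0)"
  proof (rule DERIV_isconst2[of 0 "pi / 2" "\<lambda>y. \<Lambda> y + \<Lambda> (- y)"])
    have D: "((\<lambda>y. \<Lambda> y + \<Lambda> (- y)) has_real_derivative 0) (at y)" if y: "\<bar>y\<bar> < pi" for y
    proof -
      have "((\<lambda>y. \<Lambda> (- y)) has_real_derivative - l y) (at y)"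
        using DERIV_mirror[of "\<lambda>y. \<Lambda> (- y)" _ "- y"] \<Lambda>[of "- y"] y l_even by simp
      from DERIV_add[OF \<Lambda>[OF y] this] show ?thesis by simp
    qed
    show "continuous_on {0..pi / 2} (\<lambda>y. \<Lambda> y + \<Lambda> (- y))"
      by (intro continuous_at_imp_continuous_on ballI DERIV_isCont[OF D]) (auto, use pi_gt_zero in linarith)
    show "((\<lambda>y. \<Lambda> y + \<Lambda> (- y)) has_real_derivative 0) (at y)" if "0 < y" "y < pi / 2" for y
      using that by (intro D) auto
  qed auto
  hence even: "\<Lambda> (- (pi / 2)) = 2 * \<Lambda> 0 - \<Lambda> (pi / 2)" by simp
  txt \<open>Integrated form of \<open>sin (2 t) = 2 sin t sin (\<pi> / 2 - t)\<close>; comparing the constant \<open>K\<close> at \<open>0\<close> and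
    \<open>\<pi> / 4\<close> keeps all arguments within \<open>[0, \<pi> / 2]\<close>.\<close>
  define K where "K = (\<lambda>t. \<Lambda> (2 * t) / 2 - \<Lambda> t + \<Lambda> (pi / 2 - t)
    + (pi / 2 - t) * ln (pi / 2 - t) - (pi / 2 - t))"
  have D: "(K has_real_derivative l (2 * t) - l t - l (pi / 2 - t) - ln (pi / 2 - t)) (at t)"
    if t: "0 \<le> t" "t \<le> pi / 4" for t
  proof -
    have bounds: "\<bar>2 * t\<bar> < pi" "\<bar>pi / 2 - t\<bar> < pi" "\<bar>t\<bar> < pi"
      and t2: "t * 2 < pi"
      using t pi_gt_zero by linarith+
    have "((\<lambda>t. \<Lambda> (2 * t)) has_real_derivative l (2 * t) * 2) (at t)"
      using bounds by (intro DERIV_chain'[of "\<lambda>t. 2 * t" _ _ _ \<Lambda>] \<Lambda>) (auto intro!: derivative_eq_intros)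
    moreover have "((\<lambda>t. \<Lambda> (pi / 2 - t)) has_real_derivative l (pi / 2 - t) * (- 1)) (at t)"
      using bounds by (intro DERIV_chain'[of "\<lambda>t. pi / 2 - t" _ _ _ \<Lambda>] \<Lambda>) (auto intro!: derivative_eq_intros)
    moreover have "(\<Lambda> has_real_derivative l t) (at t)"
      using bounds by (intro \<Lambda>) auto
    ultimately show ?thesis
      unfolding K_def using t2 by (auto intro!: derivative_eq_intros)
  qed
  have zero: "l (2 * t) - l t - l (pi / 2 - t) - ln (pi / 2 - t) = 0"
    if t: "0 < t" "t < pi / 4" for t
  proof -
    have pos: "sin t > 0" "cos t > 0"
      using t by (auto intro!: sin_gt_zero cos_gt_zero)
    have "sin (2 * t) / (2 * t) = sin t * cos t / t"
      by (simp add: sin_double)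
    hence "l (2 * t) = ln (sin t * cos t / t)"
      by (simp only: l_def)
    moreover have "l t = ln (sin t / t)"
      by (simp add: l_def)
    moreover have "l (pi / 2 - t) = ln (cos t / (pi / 2 - t))"
      using t by (auto simp: l_def sin_cos_eq)
    ultimately show ?thesis
      using t pos by (simp add: ln_div ln_mult)
  qed
  \<comment> \<open>At \<open>pi / 4\<close> the terms \<open>\<Lambda> t\<close> and
    \<open>\<Lambda> (pi / 2 - t)\<close> cancel, so the equation determines
    \<open>\<Lambda> (pi / 2) - \<Lambda> 0\<close>.\<close>
  have "K (pi / 4) = K 0"
  proof (rule DERIV_isconst2[of 0 "pi / 4" K])
    show "continuous_on {0..pi / 4} K"
      by (intro continuous_at_imp_continuous_on ballI DERIV_isCont[OF D]) auto
    show "(K has_real_derivative 0) (at t)" if "0 < t" "t < pi / 4" for t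
      using D[of t] zero[of t] that by simp
  qed auto
  moreover have "ln (pi / 4) = ln pi - 2 * ln 2" "ln (pi / 2) = ln pi - ln 2"
    using ln_realpow[of 2 2] by (simp_all add: ln_div)
  ultimately show ?thesis
    using even by (simp add: K_def field_simps)
qed

text \<open>On the horizontal line through \<open>z\<close> the real part is even about
  \<open>z\<close>, so its derivative there is 0. Applied to \<open>L\<close>, this makes the
  derivative purely imaginary on the imaginary axis.\<close>

lemma Re_deriv_eq_0_if_even:
  fixes f :: "complex \<Rightarrow> complex"
  assumes f: "(f has_field_derivative f') (at z)"
    and even: "\<And>t::real. Re (f (z - of_real t)) = Re (f (z + of_real t))"
  shows "Re f' = 0"
proof -
  have "((\<lambda>t. z + of_real t) has_vector_derivative 1) (at 0)"
    by (auto intro!: derivative_eq_intros)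
  hence "((\<lambda>t. f (z + of_real t)) has_vector_derivative f') (at 0)"
    using field_vector_diff_chain_at[of "\<lambda>t. z + of_real t" 1 0 f f'] f
    by (simp add: o_def)
  hence D: "((\<lambda>t. Re (f (z + of_real t))) has_real_derivative Re f') (at 0)"
    by (auto simp: has_vector_derivative_complex_iff has_real_derivative_iff_has_vector_derivative)
  with DERIV_mirror[of "\<lambda>t. Re (f (z + of_real t))" "Re f'" 0] even
  have "((\<lambda>t. Re (f (z + of_real t))) has_real_derivative - Re f') (at 0)"
    by simp
  from DERIV_unique[OF D this] show ?thesis by simp
qed

text \<open>Reflection in the imaginary axis, \<open>z\<close> to \<open>- cnj z\<close>, exchanges
  the two arguments; \<open>sinh\<close> is odd and commutes with conjugation.\<close>

lemma norm_sinhc_reflect: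
  "norm (sinh (\<i> * of_real y - of_real t) / (\<i> * of_real y - of_real t)) =
   norm (sinh (\<i> * of_real y + of_real t) / (\<i> * of_real y + of_real t))"
proof -
  define z where "z = \<i> * of_real y + (of_real t :: complex)"
  have z: "\<i> * of_real y - of_real t = - cnj z" by (simp add: z_def)
  have "sinh (cnj z) = cnj (sinh z)"
    by (simp add: sinh_field_def exp_cnj)
  thus ?thesis
    unfolding z unfolding z_def[symmetric] by (simp add: norm_divide)
qed

text \<open>With \<open>L\<close> the logarithm of \<open>sinh z / z\<close> and
  \<open>w = i y\<close>, Taylor expansion gives \<open>L (w - a) - L (w + a) = - 2 L1 w a\<close>
  up to a quadratic error. As \<open>L1 w\<close> is purely imaginary, the real part is
  \<open>2 Im a \<kappa> y\<close> with \<open>\<kappa> y = Im (L1 w)\<close>. The remaining clauses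
  allow \<kappa> to be integrated by parts.\<close>

lemma ln_sinhc_expansion:
  obtains \<kappa> \<Lambda> :: "real \<Rightarrow> real" and M :: real
  where "\<And>y a. \<bar>y\<bar> \<le> 2 \<Longrightarrow> norm a \<le> 1 \<Longrightarrow>
      \<bar>ln (norm (sinh (\<i> * of_real y - a) / (\<i> * of_real y - a)))
       - ln (norm (sinh (\<i> * of_real y + a) / (\<i> * of_real y + a))) - 2 * Im a * \<kappa> y\<bar>
      \<le> M * norm a ^ 2"
    and "\<And>y. \<bar>y\<bar> < pi \<Longrightarrow> ((\<lambda>y. ln (sin y / y)) has_real_derivative - \<kappa> y) (at y)"
    and "\<And>y. \<bar>y\<bar> < pi \<Longrightarrow> (\<Lambda> has_real_derivative ln (sin y / y)) (at y)"
    and "continuous_on {-3..3} \<kappa>"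
proof -
  obtain L L1 L2 \<Phi> :: "complex \<Rightarrow> complex"
    where ReL: "\<And>z. z \<in> strip \<Longrightarrow> Re (L z) = ln (norm (sinh z / z))"
      and L: "\<And>z. z \<in> strip \<Longrightarrow> (L has_field_derivative L1 z) (at z)"
      and L1: "\<And>z. z \<in> strip \<Longrightarrow> (L1 has_field_derivative L2 z) (at z)"
      and L2: "continuous_on strip L2"
      and \<Phi>: "\<And>z. z \<in> strip \<Longrightarrow> (\<Phi> has_field_derivative L z) (at z)"
    using strip_log_sinhc by metis
  \<comment> \<open>The rectangle contains \<open>i y\<close> and \<open>i y \<plusminus> a\<close>
    for |y| \<le> 2 and \<open>norm a \<le> 1\<close>, and lies in the strip because 3 < \<pi>. Its
    compactness makes \<open>M\<close> uniform.\<close>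
  define K where "K = cbox (Complex (-1) (-3)) (Complex 1 3)"
  have K: "z \<in> K \<longleftrightarrow> \<bar>Re z\<bar> \<le> 1 \<and> \<bar>Im z\<bar> \<le> 3" for z
    by (auto simp: K_def in_cbox_complex_iff)
  have K_strip: "K \<subseteq> strip"
    using pi_gt3 by (auto simp: K strip_def)
  have axis: "\<i> * of_real y \<in> strip" if "\<bar>y\<bar> < pi" for y
    using that by (simp add: strip_def)
  have "compact (L2 ` K)"
    using continuous_on_subset[OF L2 K_strip] by (intro compact_continuous_image) (auto simp: K_def)
  then obtain M where M: "\<And>z. z \<in> K \<Longrightarrow> norm (L2 z) \<le> M"
    using compact_imp_bounded bounded_iff by (metis imageI)
  have ReL1: "Re (L1 (\<i> * of_real y)) = 0" if y: "\<bar>y\<bar> < pi" for y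
  proof (rule Re_deriv_eq_0_if_even[OF L[OF axis[OF y]]])
    fix t :: real
    have "\<i> * of_real y - of_real t \<in> strip" "\<i> * of_real y + of_real t \<in> strip"
      using y by (auto simp: strip_def)
    thus "Re (L (\<i> * of_real y - of_real t)) = Re (L (\<i> * of_real y + of_real t))"
      using norm_sinhc_reflect by (simp only: ReL)
  qed
  have Taylor: "norm (L (w + a) - L w - L1 w * a) \<le> M * norm a ^ 2"
    if "w \<in> K" "w + a \<in> K" for w a
  proof -
    define f where "f = (\<lambda>i::nat. if i = 0 then L else if i = 1 then L1 else L2)"
    have "norm (f 0 (w + a) - (\<Sum>i\<le>1. f i w * (w + a - w) ^ i / fact i))
        \<le> M * norm (w + a - w) ^ Suc 1 / fact 1"
    proof (rule complex_Taylor[where S = K])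
      show "(f i has_field_derivative f (Suc i) x) (at x within K)" if "x \<in> K" "i \<le> 1" for i x
        using that K_strip L[of x] L1[of x]
        by (cases i) (auto simp: f_def intro: has_field_derivative_at_within)
    qed (use that M in \<open>auto simp: f_def K_def\<close>)
    thus ?thesis by (simp add: f_def power2_eq_square algebra_simps)
  qed
  have ReL_axis: "Re (L (\<i> * of_real y)) = ln (sin y / y)" if y: "\<bar>y\<bar> < pi" for y
  proof -
    have "sin y / y \<ge> 0"
      using y sin_ge_zero[of y] sin_ge_zero[of "- y"]
      by (cases "y \<ge> 0") (auto simp: zero_le_divide_iff)
    moreover have "sinh (\<i> * of_real y) / (\<i> * of_real y) = of_real (sin y / y)"
      by (simp add: sinh_conv_sin sin_of_real)
    ultimately show ?thesis
      using ReL[OF axis[OF y]] by (simp only: norm_of_real abs_of_nonneg)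
  qed
  show thesis
  proof (rule that[where M = "2 * M" and \<kappa> = "\<lambda>y. Im (L1 (\<i> * of_real y))"
      and \<Lambda> = "\<lambda>y. Im (\<Phi> (\<i> * of_real y))"])
    fix y :: real and a :: complex
    assume y: "\<bar>y\<bar> \<le> 2" and a: "norm a \<le> 1"
    have "y < pi" "- y < pi" using y pi_gt3 by auto
    hence y': "\<bar>y\<bar> < pi" by auto
    define w where "w = \<i> * complex_of_real y"
    have "\<bar>Re a\<bar> \<le> 1" "\<bar>Im a\<bar> \<le> 1"
      using a abs_Re_le_cmod[of a] abs_Im_le_cmod[of a] by linarith+
    hence in_K: "w \<in> K" "w + a \<in> K" "w - a \<in> K"
      using y by (auto simp: K w_def)
    have "Re (L (w - a)) - Re (L (w + a)) - 2 * Im a * Im (L1 w)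
        = Re ((L (w - a) - L w - L1 w * (- a)) - (L (w + a) - L w - L1 w * a))"
      using ReL1[OF y'] by (simp add: w_def)
    also have "\<bar>\<dots>\<bar> \<le> norm ((L (w - a) - L w - L1 w * (- a)) - (L (w + a) - L w - L1 w * a))"
      by (rule abs_Re_le_cmod)
    also have "\<dots> \<le> M * norm a ^ 2 + M * norm a ^ 2"
      using Taylor[of w a] Taylor[of w "- a"] in_K
      by (intro order_trans[OF norm_triangle_ineq4 add_mono]) auto
    finally show "\<bar>ln (norm (sinh (\<i> * of_real y - a) / (\<i> * of_real y - a)))
       - ln (norm (sinh (\<i> * of_real y + a) / (\<i> * of_real y + a)))
       - 2 * Im a * Im (L1 (\<i> * of_real y))\<bar> \<le> 2 * M * norm a ^ 2"
      using in_K K_strip by (simp add: subset_iff ReL flip: w_def)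
  next
    fix y :: real assume y: "\<bar>y\<bar> < pi"
    have near: "\<forall>\<^sub>F x in nhds y. \<bar>x\<bar> < pi"
    proof -
      have "open {- pi<..<pi}" "y \<in> {- pi<..<pi}" using y by auto
      from eventually_nhds_in_open[OF this] show ?thesis
        by eventually_elim auto
    qed
    show "((\<lambda>y. ln (sin y / y)) has_real_derivative - Im (L1 (\<i> * of_real y))) (at y)"
      using DERIV_Re_imag_axis(1)[OF L[OF axis[OF y]]]
      by (rule DERIV_cong_ev[THEN iffD1, rotated 3])
         (use near in \<open>auto elim!: eventually_mono simp: ReL_axis\<close>)
    show "((\<lambda>y. Im (\<Phi> (\<i> * of_real y))) has_real_derivative ln (sin y / y)) (at y)"
      using DERIV_Re_imag_axis(2)[OF \<Phi>[OF axis[OF y]]] ReL_axis[OF y] by simp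
  next
    have "continuous_on strip L1"
      using L1 by (meson DERIV_isCont continuous_at_imp_continuous_on)
    moreover have "(\<lambda>y. \<i> * complex_of_real y) ` {-3..3} \<subseteq> strip"
      using pi_gt3 by (auto simp: strip_def)
    moreover have "continuous_on {-3..3} (\<lambda>y. \<i> * complex_of_real y)"
      by (intro continuous_intros)
    ultimately have "continuous_on {-3..3} (\<lambda>y. L1 (\<i> * of_real y))"
      by (metis continuous_on_compose2)
    thus "continuous_on {-3..3} (\<lambda>y. Im (L1 (\<i> * of_real y)))"
      by (rule continuous_on_Im)
  qed
qed

subsection \<open>The regular part\<close>

text \<open>Expansion in \<open>a = A / (2 n)\<close> replaces the sum by \<open>Im A\<close> times
  a Riemann sum of \<open>f\<close> over [-1/4, 1/4]. The \<open>2 p + 1\<close> errors are of order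
  \<open>1 / n^2\<close> each and vanish in the limit.\<close>

lemma regular_part_tendsto:
  fixes A :: complex and \<delta> :: real
  assumes \<delta>: "\<bar>\<delta>\<bar> \<le> 1 / 4"
  defines "n \<equiv> \<lambda>p::nat. 4 * real p + 2 + 4 * \<delta>"
  defines "z \<equiv> \<lambda>p k. \<i> * of_real (2 * pi * (of_int k + \<delta>) / n p)"
  shows "(\<lambda>p. \<Sum>k=-int p..int p. (1 / 4 + (of_int k + \<delta>) / n p) *
      (ln (norm (sinh (z p k - A / of_real (2 * n p)) / (z p k - A / of_real (2 * n p))))
     - ln (norm (sinh (z p k + A / of_real (2 * n p)) / (z p k + A / of_real (2 * n p))))))
    \<longlonglongrightarrow> Im A * (1 - ln 2) / (4 * pi)"
proof -
  obtain \<kappa> \<Lambda> :: "real \<Rightarrow> real" and M :: real where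
    expansion: "\<And>y a. \<bar>y\<bar> \<le> 2 \<Longrightarrow> norm a \<le> 1 \<Longrightarrow>
      \<bar>ln (norm (sinh (\<i> * of_real y - a) / (\<i> * of_real y - a)))
       - ln (norm (sinh (\<i> * of_real y + a) / (\<i> * of_real y + a))) - 2 * Im a * \<kappa> y\<bar>
      \<le> M * norm a ^ 2"
    and \<kappa>: "\<And>y. \<bar>y\<bar> < pi \<Longrightarrow> ((\<lambda>y. ln (sin y / y)) has_real_derivative - \<kappa> y) (at y)"
    and \<Lambda>: "\<And>y. \<bar>y\<bar> < pi \<Longrightarrow> (\<Lambda> has_real_derivative ln (sin y / y)) (at y)"
    and cont: "continuous_on {-3..3} \<kappa>"
    by (rule ln_sinhc_expansion) blast
  define x where "x = (\<lambda>p k. (of_int k + \<delta>) / n p)"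
  define a where "a = (\<lambda>p. A / of_real (2 * n p))"
  define f where "f = (\<lambda>x. (1 / 4 + x) * \<kappa> (2 * pi * x))"
  \<comment> \<open>A primitive of \<open>f\<close> by parts: \<open>- \<kappa>\<close> is the
    derivative of \<open>ln (sin y / y)\<close>, whose own primitive is \<Lambda>.\<close>
  define F where "F = (\<lambda>x. \<Lambda> (2 * pi * x) / (4 * pi\<^sup>2)
    - (1 / 4 + x) * ln (sin (2 * pi * x) / (2 * pi * x)) / (2 * pi))"
  have n_pos: "n p > 0" for p using \<delta> by (simp add: n_def)
  have n_lim: "filterlim n at_top sequentially" "(\<lambda>p. (real p + 1 / 2) / n p) \<longlonglongrightarrow> 1 / 4"
    unfolding n_def by real_asymp+
  \<comment> \<open>The bound 3/8 exceeds 1/4 and keeps |2 \<pi> t| below both \<pi> and 3.\<close>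
  have F_deriv: "(F has_real_derivative f t) (at t)" if t: "\<bar>t\<bar> \<le> 3 / 8" for t
  proof -
    have "\<bar>2 * pi * t\<bar> = 2 * pi * \<bar>t\<bar>" by (simp add: abs_mult)
    also have "\<dots> \<le> 2 * pi * (3 / 8)" using t by (intro mult_left_mono) auto
    also have "\<dots> < pi" by simp
    finally have t': "\<bar>2 * pi * t\<bar> < pi" .
    have lin: "((\<lambda>t. 2 * pi * t) has_real_derivative 2 * pi) (at t)"
      by (auto intro!: derivative_eq_intros)
    have "((\<lambda>t. 1 / 4 + t) has_real_derivative 1) (at t)"
      by (auto intro!: derivative_eq_intros)
    from DERIV_diff[OF DERIV_cdivide[OF DERIV_chain'[OF lin \<Lambda>[OF t']]]
        DERIV_cdivide[OF DERIV_mult[OF this DERIV_chain'[OF lin \<kappa>[OF t']]]]]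
    show ?thesis unfolding F_def f_def
      by (rule DERIV_cong) (simp add: field_simps power2_eq_square)
  qed
  have f_cont: "continuous_on {-(3 / 8)..3 / 8} f"
  proof -
    have "(\<lambda>x. 2 * pi * x) ` {-(3 / 8)..3 / 8} \<subseteq> {-3..3}"
    proof safe
      fix t :: real assume "t \<in> {-(3 / 8)..3 / 8}"
      hence "2 * pi * \<bar>t\<bar> \<le> 2 * 4 * (3 / 8)"
        using pi_less_4 by (intro mult_mono) auto
      hence "\<bar>2 * pi * t\<bar> \<le> 3" by (simp add: abs_mult)
      thus "2 * pi * t \<in> {-3..3}" by (simp add: abs_le_iff)
    qed
    hence "continuous_on {-(3 / 8)..3 / 8} (\<lambda>x. \<kappa> (2 * pi * x))"
      by (rule continuous_on_compose2[OF cont, rotated]) (intro continuous_intros)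
    thus ?thesis unfolding f_def
      by (intro continuous_intros)
  qed
  have "(\<lambda>p. (\<Sum>k=-int p..int p. f (x p k)) / n p) \<longlonglongrightarrow> F (1 / 4) - F (- (1 / 4))"
    unfolding x_def using \<delta>
    by (intro Riemann_sum_symmetric[where c = "3 / 8"] F_deriv f_cont n_lim) auto
  also have "F (1 / 4) - F (- (1 / 4)) = (1 - ln 2) / (4 * pi)"
  proof -
    \<comment> \<open>The weight \<open>1 / 4 + x\<close> vanishes at \<open>- 1 / 4\<close>, so
      only the boundary term at \<open>1 / 4\<close> survives.\<close>
    have "F (1 / 4) - F (- (1 / 4)) = (\<Lambda> (pi / 2) - \<Lambda> (- (pi / 2))) / (4 * pi\<^sup>2)
        - ln (2 / pi) / (4 * pi)"
      by (simp add: F_def diff_divide_distrib)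
    also have "\<Lambda> (pi / 2) - \<Lambda> (- (pi / 2)) = pi * (1 - ln pi)"
      using \<Lambda> by (rule integral_ln_sinc)
    also have "pi * (1 - ln pi) / (4 * pi\<^sup>2) - ln (2 / pi) / (4 * pi) = (1 - ln 2) / (4 * pi)"
      by (simp add: ln_div field_simps power2_eq_square)
    finally show ?thesis .
  qed
  finally have main: "(\<lambda>p. Im A * ((\<Sum>k=-int p..int p. f (x p k)) / n p))
      \<longlonglongrightarrow> Im A * ((1 - ln 2) / (4 * pi))"
    by (rule tendsto_mult_left)
  define T where "T = (\<lambda>p k. ln (norm (sinh (z p k - a p) / (z p k - a p)))
     - ln (norm (sinh (z p k + a p) / (z p k + a p))))"
  have "(\<lambda>p. (\<Sum>k=-int p..int p. (1 / 4 + x p k) * T p k)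
      - Im A * ((\<Sum>k=-int p..int p. f (x p k)) / n p)) \<longlonglongrightarrow> 0"
  proof (rule Lim_null_comparison)
    have "(\<lambda>p. (2 * real p + 1) / n p ^ 2) \<longlonglongrightarrow> 0"
      unfolding n_def by real_asymp
    hence "(\<lambda>p. M * norm A ^ 2 / 4 * ((2 * real p + 1) / n p ^ 2)) \<longlonglongrightarrow> 0"
      by (rule tendsto_mult_right_zero)
    thus "(\<lambda>p. (2 * real p + 1) * (M * (norm A / (2 * n p)) ^ 2)) \<longlonglongrightarrow> 0"
      by (simp add: power_divide power_mult_distrib mult_ac)
    have "\<forall>\<^sub>F p in sequentially. n p \<ge> norm A"
      using n_lim(1) by (simp add: filterlim_at_top)
    thus "\<forall>\<^sub>F p in sequentially. norm ((\<Sum>k=-int p..int p. (1 / 4 + x p k) * T p k)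
      - Im A * ((\<Sum>k=-int p..int p. f (x p k)) / n p))
      \<le> (2 * real p + 1) * (M * (norm A / (2 * n p)) ^ 2)"
    proof eventually_elim
      case (elim p)
      have norm_a: "norm (a p) = norm A / (2 * n p)"
        using n_pos[of p] by (simp add: a_def norm_divide)
      have a_le: "norm (a p) \<le> 1"
        unfolding norm_a using elim n_pos[of p] by (simp add: divide_simps)
      have Im_a: "2 * Im (a p) = Im A / n p"
        unfolding a_def Im_divide_of_real by simp
      have step: "\<bar>(1 / 4 + x p k) * T p k - Im A * (f (x p k) / n p)\<bar>
          \<le> M * (norm A / (2 * n p)) ^ 2" if k: "k \<in> {-int p..int p}" for k
      proof -
        have "of_int k \<le> real p" "- real p \<le> of_int k" using k by auto
        moreover have "- 1 / 4 \<le> \<delta>" "\<delta> \<le> 1 / 4" using \<delta> by auto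
        \<comment> \<open>Here \<open>n p / 4 = p + 1 / 2 + \<delta>\<close>, which dominates
          \<open>p + \<bar>\<delta>\<bar>\<close> as soon as \<delta> \<ge> -1/4.\<close>
        ultimately have "\<bar>of_int k + \<delta>\<bar> \<le> n p / 4"
          by (intro abs_leI) (simp_all add: n_def)
        hence xb: "\<bar>x p k\<bar> \<le> 1 / 4"
          using n_pos[of p] by (simp add: x_def abs_divide divide_simps)
        have z: "z p k = \<i> * of_real (2 * pi * x p k)"
          by (simp add: z_def x_def)
        have "\<bar>2 * pi * x p k\<bar> = 2 * pi * \<bar>x p k\<bar>" by (simp add: abs_mult)
        also have "\<dots> \<le> 2 * 4 * (1 / 4)"
          using xb pi_less_4 by (intro mult_mono) auto
        finally have "\<bar>T p k - 2 * Im (a p) * \<kappa> (2 * pi * x p k)\<bar> \<le> M * norm (a p) ^ 2"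
          unfolding T_def z using a_le by (intro expansion) auto
        hence *: "\<bar>T p k - Im A / n p * \<kappa> (2 * pi * x p k)\<bar> \<le> M * (norm A / (2 * n p)) ^ 2"
          unfolding Im_a norm_a .
        have "(1 / 4 + x p k) * T p k - Im A * (f (x p k) / n p)
            = (1 / 4 + x p k) * (T p k - Im A / n p * \<kappa> (2 * pi * x p k))"
          by (simp add: f_def algebra_simps)
        also have "\<bar>\<dots>\<bar> \<le> 1 * \<bar>T p k - Im A / n p * \<kappa> (2 * pi * x p k)\<bar>"
          unfolding abs_mult using xb by (intro mult_right_mono) auto
        also have "\<dots> \<le> M * (norm A / (2 * n p)) ^ 2" using * by simp
        finally show ?thesis .
      qed
      have "(\<Sum>k=-int p..int p. (1 / 4 + x p k) * T p k)
          - Im A * ((\<Sum>k=-int p..int p. f (x p k)) / n p)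
          = (\<Sum>k=-int p..int p. (1 / 4 + x p k) * T p k - Im A * (f (x p k) / n p))"
        by (simp add: sum_subtractf sum_divide_distrib sum_distrib_left)
      also have "\<bar>\<dots>\<bar> \<le> (\<Sum>k=-int p..int p. M * (norm A / (2 * n p)) ^ 2)"
        using step by (intro order_trans[OF sum_abs sum_mono]) auto
      finally show ?case by (simp add: add_ac)
    qed
  qed
  from tendsto_add[OF this main] show ?thesis
    by (simp add: T_def x_def a_def)
qed

subsection \<open>The singular part\<close>

text \<open>The product of \<open>z + k\<close> over |k| \<le> p is the partial Euler product
  \<open>Q p z\<close> of \<open>sin (pi z)\<close> times a factor independent of \<open>z\<close>,
  which cancels in the quotient.\<close>

lemma sum_ln_norm_shift_tendsto:
  fixes v w :: complex
  assumes v: "\<And>k::int. v + of_int k \<noteq> 0" and w: "\<And>k::int. w + of_int k \<noteq> 0"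
  shows "(\<lambda>p. \<Sum>k=-int p..int p. ln (norm (v + of_int k)) - ln (norm (w + of_int k)))
    \<longlonglongrightarrow> ln (norm (sin (of_real pi * v) / sin (of_real pi * w)))"
proof -
  define Q where "Q = (\<lambda>p z. of_real pi * z * (\<Prod>k=1..p. 1 - z\<^sup>2 / of_nat k ^ 2 :: complex))"
  have Q: "(\<lambda>p. Q p z) \<longlonglongrightarrow> sin (of_real pi * z)" for z
    unfolding Q_def by (rule sin_product_formula_complex)
  have sin_nz: "sin (of_real pi * z) \<noteq> 0" if z: "\<And>k::int. z + of_int k \<noteq> 0" for z :: complex
  proof
    assume "sin (of_real pi * z) = 0"
    then obtain k :: int where "of_real pi * z = of_real (of_int k * pi)"
      by (auto simp: sin_eq_0)
    hence "z + of_int (- k) = 0" by simp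
    thus False using z by blast
  qed
  have prod: "(\<Prod>k=-int p..int p. z + of_int k)
      = Q p z * ((\<Prod>k=1..p. - (of_nat k ^ 2)) / of_real pi)" for p and z :: complex
  proof (induction p)
    case (Suc p)
    have "{-int (Suc p)..int (Suc p)} =
        insert (int (Suc p)) (insert (- int (Suc p)) {-int p..int p})"
      by auto
    hence "(\<Prod>k=-int (Suc p)..int (Suc p). z + of_int k)
        = (z\<^sup>2 - of_nat (Suc p) ^ 2) * (\<Prod>k=-int p..int p. z + of_int k)"
      by (simp add: power2_eq_square algebra_simps)
    also have "z\<^sup>2 - of_nat (Suc p) ^ 2 = (1 - z\<^sup>2 / of_nat (Suc p) ^ 2) * (- (of_nat (Suc p) ^ 2))"
      by (simp add: field_simps del: of_nat_Suc)
    finally show ?case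
      using Suc by (simp add: Q_def del: of_nat_Suc)
  qed (simp add: Q_def)
  have "(\<Sum>k=-int p..int p. ln (norm (v + of_int k)) - ln (norm (w + of_int k)))
      = ln (norm (Q p v / Q p w))" for p
  proof -
    have pos: "(\<Prod>k=-int p..int p. norm (v + of_int k)) > 0" "(\<Prod>k=-int p..int p. norm (w + of_int k)) > 0"
      using v w by (auto intro!: prod_pos)
    have "(\<Sum>k=-int p..int p. ln (norm (v + of_int k)) - ln (norm (w + of_int k)))
        = ln (\<Prod>k=-int p..int p. norm (v + of_int k)) - ln (\<Prod>k=-int p..int p. norm (w + of_int k))"
      using v w by (simp add: sum_subtractf ln_prod)
    also have "\<dots> = ln (norm ((\<Prod>k=-int p..int p. v + of_int k) / (\<Prod>k=-int p..int p. w + of_int k)))"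
      using pos by (simp add: ln_div norm_divide prod_norm)
    also have "(\<Prod>k=-int p..int p. v + of_int k) / (\<Prod>k=-int p..int p. w + of_int k) = Q p v / Q p w"
      unfolding prod by simp
    finally show ?thesis .
  qed
  moreover have "(\<lambda>p. ln (norm (Q p v / Q p w)))
      \<longlonglongrightarrow> ln (norm (sin (of_real pi * v) / sin (of_real pi * w)))"
    using sin_nz[OF v] sin_nz[OF w] by (intro tendsto_intros Q) auto
  ultimately show ?thesis by simp
qed

text \<open>This rests on \<open>ln (norm (1 + w / x)) = Re w / x + O(1 / x^2)\<close>, taken for
  \<open>w\<close> and \<open>- w\<close>.\<close>

lemma ln_norm_ratio_asymp:
  fixes w :: complex
  shows "((\<lambda>x. x * (ln (norm (of_real x + w)) - ln (norm (of_real x - w)))) \<longlongrightarrow> 2 * Re w) at_top"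
proof -
  define a b where "a = Re w" and "b = Im w"
  have "((\<lambda>x. x * (ln (sqrt ((x + a)\<^sup>2 + b\<^sup>2)) - ln (sqrt ((x - a)\<^sup>2 + b\<^sup>2)))) \<longlongrightarrow> 2 * a) at_top"
    by real_asymp
  thus ?thesis
    by (simp add: cmod_def a_def b_def)
qed

text \<open>By evenness, \<open>k\<close> and \<open>- k\<close> together contribute
  \<open>g (k + \<delta>) + g (k - \<delta>)\<close>, which tends to \<open>2 l\<close>. There are
  \<open>p\<close> such pairs and the divisor grows like \<open>4 p\<close>, hence
  \<open>l / 2\<close>.\<close>

lemma Cesaro_int_even:
  fixes g :: "real \<Rightarrow> real" and \<delta> :: real
  assumes g: "(g \<longlongrightarrow> l) at_top" and even: "\<And>x. g (- x) = g x"
  defines "n \<equiv> \<lambda>p::nat. 4 * real p + 2 + 4 * \<delta>"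
  shows "(\<lambda>p. (\<Sum>k=-int p..int p. g (of_int k + \<delta>)) / n p) \<longlonglongrightarrow> l / 2"
proof -
  have "filterlim (\<lambda>k::nat. real k + \<delta>) at_top sequentially"
    "filterlim (\<lambda>k::nat. real k - \<delta>) at_top sequentially"
    by real_asymp+
  hence "(\<lambda>k. g (real k + \<delta>) + g (real k - \<delta>)) \<longlonglongrightarrow> l + l"
    by (intro tendsto_add filterlim_compose[OF g])
  also have "(\<lambda>k. g (real k + \<delta>) + g (real k - \<delta>))
      = (\<lambda>k. g (of_int (int k) + \<delta>) + g (of_int (- int k) + \<delta>))"
    using even by (metis (no_types, opaque_lifting) minus_diff_eq of_int_minus of_int_of_nat_eq uminus_add_conv_diff)
  finally have *: "(\<lambda>p. (\<Sum>k=1..p. g (of_int (int k) + \<delta>) + g (of_int (- int k) + \<delta>)) / real p)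
      \<longlonglongrightarrow> l + l"
    by (rule Cesaro_mean_tendsto)
  have "(\<lambda>p. real p / n p) \<longlonglongrightarrow> 1 / 4" "(\<lambda>p. g \<delta> / n p) \<longlonglongrightarrow> 0"
    unfolding n_def by real_asymp+
  from tendsto_add[OF this(2) tendsto_mult[OF * this(1)]]
  have "(\<lambda>p. g \<delta> / n p + (\<Sum>k=1..p. g (of_int (int k) + \<delta>) + g (of_int (- int k) + \<delta>))
      / real p * (real p / n p)) \<longlonglongrightarrow> l / 2" by simp
  thus ?thesis
  proof (rule Lim_transform_eventually)
    show "\<forall>\<^sub>F p in sequentially. g \<delta> / n p
        + (\<Sum>k=1..p. g (of_int (int k) + \<delta>) + g (of_int (- int k) + \<delta>)) / real p * (real p / n p)
        = (\<Sum>k=-int p..int p. g (of_int k + \<delta>)) / n p"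
      using eventually_gt_at_top[of 0]
      by eventually_elim (simp add: sum_int_symmetric add_divide_distrib)
  qed
qed

text \<open>The weight 1/4 yields a quarter of the logarithm of the sine quotient. The weight
  \<open>s / n\<close> yields a Cesaro mean of the even function \<open>s * R s\<close>, which tends
  to \<open>2 Re w\<close>.\<close>

lemma singular_part_tendsto:
  fixes w :: complex and \<delta> :: real
  assumes nz: "\<And>k::int. of_real (of_int k + \<delta>) \<noteq> w" "\<And>k::int. of_real (of_int k + \<delta>) \<noteq> - w"
  defines "n \<equiv> \<lambda>p::nat. 4 * real p + 2 + 4 * \<delta>"
  defines "R \<equiv> \<lambda>s::real. ln (norm (of_real s + w)) - ln (norm (of_real s - w))"
  shows "(\<lambda>p. \<Sum>k=-int p..int p. (1 / 4 + (of_int k + \<delta>) / n p) * R (of_int k + \<delta>))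
    \<longlonglongrightarrow> ln (norm (sin (of_real pi * (of_real \<delta> + w)) / sin (of_real pi * (of_real \<delta> - w)))) / 4 + Re w"
proof -
  have "(\<lambda>p. \<Sum>k=-int p..int p. ln (norm (of_real \<delta> + w + of_int k)) - ln (norm (of_real \<delta> - w + of_int k)))
    \<longlonglongrightarrow> ln (norm (sin (of_real pi * (of_real \<delta> + w)) / sin (of_real pi * (of_real \<delta> - w))))"
  proof (rule sum_ln_norm_shift_tendsto)
    show "of_real \<delta> + w + of_int k \<noteq> 0" for k
      using nz(2)[of k] by (auto simp: algebra_simps add_eq_0_iff)
    show "of_real \<delta> - w + of_int k \<noteq> 0" for k
      using nz(1)[of k] by (auto simp: algebra_simps)
  qed
  hence 1: "(\<lambda>p. \<Sum>k=-int p..int p. R (of_int k + \<delta>))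
    \<longlonglongrightarrow> ln (norm (sin (of_real pi * (of_real \<delta> + w)) / sin (of_real pi * (of_real \<delta> - w))))"
    by (simp add: R_def algebra_simps)
  have R_odd: "R (- s) = - R s" for s
  proof -
    have "norm (of_real (- s) + w) = norm (of_real s - w)"
      by (metis norm_minus_commute of_real_minus uminus_add_conv_diff)
    moreover have "norm (of_real (- s) - w) = norm (of_real s + w)"
      by (metis minus_add_distrib norm_minus_cancel of_real_minus uminus_add_conv_diff add.commute)
    ultimately show ?thesis by (simp add: R_def)
  qed
  have 2: "(\<lambda>p. (\<Sum>k=-int p..int p. (of_int k + \<delta>) * R (of_int k + \<delta>)) / n p) \<longlonglongrightarrow> 2 * Re w / 2"
    unfolding n_def
  proof (rule Cesaro_int_even[where g = "\<lambda>s. s * R s"])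
    show "((\<lambda>s. s * R s) \<longlongrightarrow> 2 * Re w) at_top"
      unfolding R_def by (rule ln_norm_ratio_asymp)
  qed (simp only: R_odd minus_mult_minus)
  have eq: "(\<Sum>k=-int p..int p. (1 / 4 + (of_int k + \<delta>) / n p) * R (of_int k + \<delta>))
      = (\<Sum>k=-int p..int p. R (of_int k + \<delta>)) / 4
        + (\<Sum>k=-int p..int p. (of_int k + \<delta>) * R (of_int k + \<delta>)) / n p" for p
    unfolding sum_divide_distrib sum.distrib[symmetric]
    by (intro sum.cong) (auto simp: algebra_simps)
  show ?thesis
    unfolding eq using tendsto_add[OF tendsto_divide[OF 1 tendsto_const[of 4]] 2] by simp
qed

subsection \<open>The product over the roots of unity\<close>

text \<open>Both sides are polynomials in \<open>u\<close> of degree at most \<open>n\<close>. They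
  agree at 0 and both vanish at the \<open>n\<close> points \<open>- inverse z\<close>, since
  \<open>n\<close> is odd; these are \<open>n + 1\<close> points.\<close>

lemma prod_one_plus_roots_of_unity:
  fixes u :: complex
  assumes S: "finite S" "card S = n" "\<And>z. z \<in> S \<Longrightarrow> z ^ n = 1" and n: "odd n"
  shows "(\<Prod>z\<in>S. 1 + u * z) = 1 + u ^ n"
proof -
  define P where "P = (\<Prod>z\<in>S. [:1, z:])"
  define Q where "Q = 1 + monom (1::complex) n"
  have nz: "z \<noteq> 0" if "z \<in> S" for z
    using S(3)[OF that] n by (metis odd_pos power_0_left zero_neq_one less_numeral_extra(3))
  have inj: "inj_on (\<lambda>z. - inverse z) S"
    by (auto intro: inj_onI)
  have "degree P \<le> (\<Sum>z\<in>S. degree [:1, z:])"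
    unfolding P_def using degree_prod_sum_le[OF S(1), of "\<lambda>z. [:1, z:]"] by (simp add: o_def)
  also have "\<dots> \<le> (\<Sum>z\<in>S. 1)" by (intro sum_mono) auto
  finally have degP: "degree P \<le> n" using S by simp
  have degQ: "degree Q \<le> n"
    unfolding Q_def by (intro degree_add_le) (auto simp: degree_monom_le)
  have "P = Q"
  proof (rule poly_eqI_degree[where A = "insert 0 ((\<lambda>z. - inverse z) ` S)"])
    show "poly P x = poly Q x" if x: "x \<in> insert 0 ((\<lambda>z. - inverse z) ` S)" for x
    proof (cases "x = 0")
      case True
      thus ?thesis using n by (simp add: P_def Q_def poly_prod poly_monom odd_pos)
    next
      case False
      then obtain z where z: "z \<in> S" "x = - inverse z" using x by auto
      have "poly P x = 0"
        using z nz S(1) by (auto simp: P_def poly_prod intro!: bexI[of _ z])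
      moreover have "poly Q x = 0"
        using z S(3)[OF z(1)] n by (simp add: Q_def poly_monom power_inverse)
      ultimately show ?thesis by simp
    qed
    have "card (insert 0 ((\<lambda>z. - inverse z) ` S)) = Suc n"
      using S inj nz by (subst card_insert_disjoint) (auto simp: card_image)
    thus "degree P < card (insert 0 ((\<lambda>z. - inverse z) ` S))"
      "degree Q < card (insert 0 ((\<lambda>z. - inverse z) ` S))"
      using degP degQ by auto
  qed
  hence "poly P u = poly Q u" by simp
  thus ?thesis by (simp add: P_def Q_def poly_prod poly_monom)
qed

text \<open>By injectivity the powers of \<open>q\<close> run through all \<open>n\<close>-th roots
  of unity, so the factors multiply to \<open>1 + u ^ n\<close>. Distributing the prefactor over
  them lowers each exponent \<open>n - j + 1\<close> by \<open>(n + 1) / 2\<close>.\<close>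

lemma ln_norm_Dq:
  assumes n: "odd n" and u: "u ^ n \<noteq> -1"
    and q: "q ^ n = 1" "inj_on (\<lambda>j. q powi (- 2 * int j)) {1..n}"
  shows "Dq n q u \<noteq> 0"
    and "ln (norm (Dq n q u)) =
      (\<Sum>j=1..n. ((real n + 1) / 2 - real j) * ln (norm (1 + u * q powi (- 2 * int j))))"
proof -
  define z where "z = (\<lambda>j::nat. q powi (- 2 * int j))"
  have "(\<Prod>w\<in>z ` {1..n}. 1 + u * w) = 1 + u ^ n"
  proof (rule prod_one_plus_roots_of_unity)
    show "card (z ` {1..n}) = n"
      using q(2) by (subst card_image) (auto simp: z_def)
    fix w assume "w \<in> z ` {1..n}"
    then obtain j where "w = q powi (- 2 * int j)" by (auto simp: z_def)
    hence "w ^ n = (q ^ n) powi (- 2 * int j)"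
      by (metis power_int_commutes power_int_mult power_int_of_nat mult.commute)
    thus "w ^ n = 1" using q(1) by simp
  qed (use n in auto)
  hence prod: "(\<Prod>j=1..n. 1 + u * z j) = 1 + u ^ n"
    using q(2) by (subst (asm) prod.reindex) (auto simp: z_def)
  have un: "1 + u ^ n \<noteq> 0" using u by (metis add.commute add_eq_0_iff)
  have nz: "1 + u * z j \<noteq> 0" if "j \<in> {1..n}" for j
    using prod un that by (metis finite_atLeastAtMost prod_zero_iff)
  have Dq: "Dq n q u = (1 + u ^ n) powi (- ((int n + 1) div 2)) * (\<Prod>j=1..n. (1 + u * z j) ^ (n - j + 1))"
    by (simp add: Dq_def z_def)
  show "Dq n q u \<noteq> 0" unfolding Dq using un nz by auto
  have half: "real_of_int ((int n + 1) div 2) = (real n + 1) / 2"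
    using n by (auto elim!: oddE)
  have "ln (norm (Dq n q u)) = ln (norm (1 + u ^ n) powi (- ((int n + 1) div 2)))
      + ln (\<Prod>j=1..n. norm (1 + u * z j) ^ (n - j + 1))"
    unfolding Dq norm_mult norm_power_int prod_norm[symmetric] norm_power using un nz
    by (subst ln_mult_pos) (auto intro!: prod_pos zero_less_power_int)
  also have "ln (norm (1 + u ^ n) powi (- ((int n + 1) div 2)))
      = - ((real n + 1) / 2) * ln (norm (1 + u ^ n))"
    using un by (subst powr_real_of_int'[symmetric]) (auto simp: ln_powr half)
  also have "ln (norm (1 + u ^ n)) = (\<Sum>j=1..n. ln (norm (1 + u * z j)))"
    unfolding prod[symmetric] prod_norm[symmetric] using nz by (subst ln_prod) auto
  also have "ln (\<Prod>j=1..n. norm (1 + u * z j) ^ (n - j + 1))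
      = (\<Sum>j=1..n. (real n - real j + 1) * ln (norm (1 + u * z j)))"
    using nz by (subst ln_prod)
      (auto intro!: sum.cong simp: ln_realpow of_nat_diff simp del: power_Suc)
  finally show "ln (norm (Dq n q u)) =
      (\<Sum>j=1..n. ((real n + 1) / 2 - real j) * ln (norm (1 + u * q powi (- 2 * int j))))"
    by (simp add: z_def sum_distrib_left sum.distrib[symmetric] algebra_simps add_divide_distrib)
qed

text \<open>This is the norm of \<open>1 - exp (2 w) = - 2 exp w sinh w\<close>. The term
  \<open>Re w\<close> cancels later between arguments of equal real part.\<close>

lemma ln_norm_one_minus_exp:
  fixes w :: complex
  assumes "sinh w \<noteq> 0"
  shows "ln (norm (1 - exp (2 * w))) = ln 2 + Re w + ln (norm (sinh w))"
proof -
  have "exp (2 * w) = exp w * exp w"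
    by (simp only: mult_2 exp_add)
  moreover have "exp w * exp (- w) = 1"
    by (simp only: exp_add[symmetric]) simp
  ultimately have "1 - exp (2 * w) = - 2 * exp w * sinh w"
    by (simp add: sinh_field_def algebra_simps)
  hence "norm (1 - exp (2 * w)) = 2 * exp (Re w) * norm (sinh w)"
    by (simp add: norm_mult)
  thus ?thesis using assms by (simp add: ln_mult)
qed

text \<open>The shifted range starts at \<open>d - p\<close>, which is 0 or 1, so the only possible
  extra term is \<open>f 0\<close>.\<close>

lemma sum_shift_int:
  fixes f :: "int \<Rightarrow> 'a::comm_monoid_add"
  assumes d: "d = p \<or> d = Suc p" and "f 0 = 0"
  shows "(\<Sum>m=1..p+d. f (int m)) = (\<Sum>k=-int p..int p. f (k + int d))"
proof -
  have "(\<Sum>m=1..p+d. f (int m)) = (\<Sum>m\<in>{1..int (p + d)}. f m)"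
    by (rule sum.reindex_bij_witness[of _ nat int]) auto
  also have "\<dots> = (\<Sum>m\<in>{int d - int p..int (p + d)}. f m)"
  proof (rule sum.mono_neutral_left)
    show "\<forall>m\<in>{int d - int p..int (p + d)} - {1..int (p + d)}. f m = 0"
    proof
      fix m assume "m \<in> {int d - int p..int (p + d)} - {1..int (p + d)}"
      hence "m = 0" using d by auto
      thus "f m = 0" using assms(2) by simp
    qed
  qed (use d in auto)
  also have "\<dots> = (\<Sum>k=-int p..int p. f (k + int d))"
    by (rule sum.reindex_bij_witness[of _ "\<lambda>k. k + int d" "\<lambda>m. m - int d"]) auto
  finally show ?thesis .
qed

lemma exp_2pi_i_powi:
  "exp (2 * of_real pi * \<i> / of_nat n) powi m = exp (of_int m * (2 * of_real pi * \<i>) / of_nat n)"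
  by (simp add: exp_power_int)

text \<open>Equal powers mean that \<open>n\<close> divides \<open>2 (j - i)\<close>; oddness
  removes the 2, and |j - i| < n forces equality.\<close>

lemma inj_on_exp_2pi_i_powi:
  assumes n: "odd n"
  shows "inj_on (\<lambda>j. exp (2 * of_real pi * \<i> / of_nat n) powi (- 2 * int j)) {1..n}"
proof (rule inj_onI)
  fix i j assume ij: "i \<in> {1..n}" "j \<in> {1..n}"
    and eq: "exp (2 * of_real pi * \<i> / of_nat n) powi (- 2 * int i)
      = exp (2 * of_real pi * \<i> / of_nat n) powi (- 2 * int j)"
  have n0: "real n > 0" using n by (auto intro: odd_pos)
  obtain k :: int where "of_int (- 2 * int i) * (2 * of_real pi * \<i>) / complex_of_nat n
      = of_int (- 2 * int j) * (2 * of_real pi * \<i>) / of_nat n + of_int (2 * k) * of_real pi * \<i>"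
    using eq unfolding exp_2pi_i_powi exp_eq by auto
  from arg_cong[OF this, of Im]
  have "- 2 * real i * (2 * pi) / real n = - 2 * real j * (2 * pi) / real n + 2 * of_int k * pi"
    by (simp add: Im_divide_of_nat)
  hence "2 * pi * (2 * (real j - real i)) = 2 * pi * (of_int k * real n)"
    using n0 by (simp add: field_simps)
  hence "2 * (real j - real i) = of_int k * real n"
    by (subst (asm) mult_cancel_left) simp
  hence "of_int (2 * (int j - int i)) = (of_int (k * int n) :: real)"
    by simp
  hence "2 * (int j - int i) = k * int n"
    by (simp only: of_int_eq_iff)
  hence "int n dvd 2 * (int j - int i)" by simp
  moreover have "coprime (int n) 2" using n by simp
  ultimately have "int n dvd int j - int i"
    by (metis coprime_dvd_mult_right_iff)
  moreover have "\<bar>int j - int i\<bar> < int n" using ij by auto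
  ultimately have "int j - int i = 0"
    using dvd_imp_le_int[of "int j - int i" "int n"] by linarith
  thus "i = j" by simp
qed

text \<open>With \<open>m = N + 1 - j\<close> the weight \<open>(n + 1) / 2 - j\<close> becomes
  \<open>m\<close> and the factor becomes \<open>\<mu> m\<close>. The weight is odd in
  \<open>m\<close>, so \<open>m\<close> and \<open>- m\<close> combine into a difference.\<close>

lemma Dq_half_sum:
  fixes A :: complex and N :: nat
  assumes A: "exp A \<noteq> -1"
  defines "n \<equiv> 2 * N + 1"
  defines "q \<equiv> exp (2 * of_real pi * \<i> / of_nat n)"
  defines "u \<equiv> q * exp (- (1 / of_nat n) * A)"
  defines "\<mu> \<equiv> \<lambda>m::int. 1 + exp ((4 * of_real pi * \<i> * of_int m - A) / of_nat n)"
  shows "\<mu> m \<noteq> 0"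
    and "Dq n q u \<noteq> 0"
    and "ln (norm (Dq n q u)) =
      (\<Sum>m=1..N. real m * (ln (norm (\<mu> (int m))) - ln (norm (\<mu> (- int m)))))"
proof -
  have n: "odd n" "n > 0" "complex_of_nat n \<noteq> 0"
    by (auto simp: n_def simp del: of_nat_Suc of_nat_add)
  have expA: "exp (- A) \<noteq> -1"
  proof
    assume "exp (- A) = -1"
    hence "inverse (inverse (exp A)) = inverse (-1)"
      by (simp only: exp_minus)
    thus False using A by simp
  qed
  show "\<mu> m \<noteq> 0"
  proof
    assume "\<mu> m = 0"
    hence "exp ((4 * of_real pi * \<i> * of_int m - A) / of_nat n) = -1"
      by (simp only: \<mu>_def add_eq_0_iff)
    \<comment> \<open>The \<open>n\<close>-th power removes the dependence on \<open>m\<close>, and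
      oddness of \<open>n\<close> leaves \<open>exp (- A) = -1\<close>.\<close>
    hence "exp (of_nat n * ((4 * of_real pi * \<i> * of_int m - A) / of_nat n)) = (-1) ^ n"
      by (simp only: exp_of_nat_mult)
    hence "exp (4 * of_real pi * \<i> * of_int m - A) = -1"
      using n by simp
    moreover have "exp (4 * of_real pi * \<i> * of_int m - A) = exp (- A)"
      unfolding exp_eq by (intro exI[of _ "2 * m"]) simp
    ultimately show False using expA by simp
  qed
  have "q ^ n = exp (2 * of_real pi * \<i>)"
    unfolding q_def exp_of_nat_mult[symmetric] using n(3) by simp
  hence q_n: "q ^ n = 1" by simp
  have "exp (- (1 / of_nat n) * A) ^ n = exp (- A)"
    unfolding exp_of_nat_mult[symmetric] using n(3) by simp
  hence "u ^ n = exp (- A)"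
    by (simp only: u_def power_mult_distrib q_n mult_1)
  hence u_n: "u ^ n \<noteq> -1" using expA by simp
  note Dq = ln_norm_Dq[OF n(1) u_n q_n inj_on_exp_2pi_i_powi[OF n(1), folded q_def]]
  show "Dq n q u \<noteq> 0" by (rule Dq(1))
  have factor: "1 + u * q powi (- 2 * int j) = \<mu> (int N + 1 - int j)" for j
  proof -
    have "u * q powi (- 2 * int j)
        = exp (2 * of_real pi * \<i> / of_nat n + - (1 / of_nat n) * A
            + of_int (- 2 * int j) * (2 * of_real pi * \<i>) / of_nat n)"
      by (simp only: u_def q_def exp_2pi_i_powi exp_add)
    also have "\<dots> = exp ((4 * of_real pi * \<i> * of_int (int N + 1 - int j) - A) / of_nat n)"
      \<comment> \<open>For \<open>m = N + 1 - j\<close> one has \<open>2 - 4 j = 4 m - 2 n\<close>: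
        the exponents differ by one period, whence the witness -1.\<close>
      unfolding exp_eq
      by (intro exI[of _ "-1"]) (use n in \<open>simp add: field_simps\<close>, simp add: n_def algebra_simps)
    finally show ?thesis by (simp add: \<mu>_def)
  qed
  have "ln (norm (Dq n q u))
      = (\<Sum>j=1..n. of_int (int N + 1 - int j) * ln (norm (\<mu> (int N + 1 - int j))))"
    unfolding Dq(2) factor by (intro sum.cong) (auto simp: n_def)
  also have "\<dots> = (\<Sum>m=-int N..int N. of_int m * ln (norm (\<mu> m)))"
    by (rule sum.reindex_bij_witness[of _ "\<lambda>m. nat (int N + 1 - m)" "\<lambda>j. int N + 1 - int j"])
       (auto simp: n_def)
  also have "\<dots> = (\<Sum>m=1..N. real m * (ln (norm (\<mu> (int m))) - ln (norm (\<mu> (- int m)))))"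
    by (simp add: sum_int_symmetric algebra_simps)
  finally show "ln (norm (Dq n q u)) =
      (\<Sum>m=1..N. real m * (ln (norm (\<mu> (int m))) - ln (norm (\<mu> (- int m)))))" .
qed

text \<open>The shift \<open>m = k + d\<close> with \<open>d = n / 4 + \<delta>\<close> splits
  \<pi>i off the exponent in \<mu>, so \<open>1 + exp\<close> becomes \<open>1 - exp\<close> and
  hence a \<open>sinh\<close>. The two cases for \<open>d\<close> are \<open>n = 4 p + 1\<close> and
  \<open>n = 4 p + 3\<close>.\<close>

lemma Dq_sinh_sum:
  fixes A :: complex and \<delta> :: real and p d :: nat
  assumes A: "exp A \<noteq> -1"
    and d: "\<delta> = - 1 / 4 \<and> d = p \<or> \<delta> = 1 / 4 \<and> d = Suc p"
  defines "n \<equiv> 2 * (p + d) + 1"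
  defines "q \<equiv> exp (2 * of_real pi * \<i> / of_nat n)"
  defines "u \<equiv> q * exp (- (1 / of_nat n) * A)"
  defines "z \<equiv> \<lambda>k. \<i> * of_real (2 * pi * (of_int k + \<delta>) / real n)"
  defines "a \<equiv> A / of_real (2 * real n)"
  shows "sinh (z k - a) \<noteq> 0" and "sinh (z k + a) \<noteq> 0" and "Dq n q u \<noteq> 0"
    and "ln (norm (Dq n q u)) / real n = (\<Sum>k=-int p..int p. (1 / 4 + (of_int k + \<delta>) / real n) *
      (ln (norm (sinh (z k - a))) - ln (norm (sinh (z k + a)))))"
proof -
  define \<mu> where "\<mu> = (\<lambda>m::int. 1 + exp ((4 * of_real pi * \<i> * of_int m - A) / of_nat n))"
  note half = Dq_half_sum[OF A, where N = "p + d", folded n_def, folded q_def, folded u_def]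
  have \<mu>_nz: "\<mu> m \<noteq> 0" for m
    unfolding \<mu>_def by (rule half(1))
  have n0: "real n > 0" by (simp add: n_def)
  have nd: "real n = 4 * real p + 2 + 4 * \<delta>" "real d = real p + 1 / 2 + 2 * \<delta>"
    using d by (auto simp: n_def)
  have dn: "real d = real n / 4 + \<delta>" using nd by simp
  have minus: "\<mu> (k + int d) = 1 - exp (2 * (z k - a))" for k
  proof -
    have "complex_of_nat d = of_nat n / 4 + of_real \<delta>"
      using arg_cong[OF dn, of complex_of_real] by simp
    hence "(4 * of_real pi * \<i> * of_int (k + int d) - A) / of_nat n
        = of_real pi * \<i> + 2 * (z k - a)"
      using n0 by (simp add: z_def a_def field_simps)
    thus ?thesis by (simp add: \<mu>_def exp_add)
  qed
  have plus: "\<mu> (- (k + int d)) = 1 - exp (2 * (- (z k + a)))" for k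
  proof -
    have "complex_of_nat d = of_nat n / 4 + of_real \<delta>"
      using arg_cong[OF dn, of complex_of_real] by simp
    hence "(4 * of_real pi * \<i> * of_int (- (k + int d)) - A) / of_nat n
        = 2 * (- (z k + a)) - of_real pi * \<i>"
      using n0 by (simp add: z_def a_def field_simps)
    thus ?thesis by (simp add: \<mu>_def exp_diff)
  qed
  have nz: "sinh w \<noteq> 0" if "1 - exp (2 * w) \<noteq> 0" for w :: complex
  proof
    assume "sinh w = 0"
    hence "exp w * exp w = exp w * exp (- w)" by (simp add: sinh_field_def)
    hence "exp (2 * w) = 1" by (simp only: exp_add[symmetric] mult_2) simp
    thus False using that by simp
  qed
  have sinh1: "sinh (z k - a) \<noteq> 0" for k
    using \<mu>_nz[of "k + int d"] unfolding minus by (rule nz)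
  have sinh2: "sinh (- (z k + a)) \<noteq> 0" for k
    using \<mu>_nz[of "- (k + int d)"] unfolding plus by (rule nz)
  show "sinh (z k - a) \<noteq> 0" "sinh (z k + a) \<noteq> 0"
    using sinh1 sinh2[of k] unfolding sinh_minus by auto
  show "Dq n q u \<noteq> 0" by (rule half(2))
  have "ln (norm (Dq n q u))
      = (\<Sum>m=1..p+d. of_int (int m) * (ln (norm (\<mu> (int m))) - ln (norm (\<mu> (- int m)))))"
    unfolding half(3) \<mu>_def by simp
  also have "\<dots> = (\<Sum>k=-int p..int p. of_int (k + int d) *
      (ln (norm (\<mu> (k + int d))) - ln (norm (\<mu> (- (k + int d))))))"
    using d by (intro sum_shift_int) auto
  also have "\<dots> = (\<Sum>k=-int p..int p. of_int (k + int d) *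
      (ln (norm (sinh (z k - a))) - ln (norm (sinh (z k + a)))))"
  proof (intro sum.cong refl arg_cong2[where f = "(*)"])
    fix k
    have "norm (sinh (- (z k + a))) = norm (sinh (z k + a))"
      unfolding sinh_minus norm_minus_cancel ..
    \<comment> \<open>Both real parts are \<open>- Re a\<close> because \<open>z k\<close> is
      imaginary, so the linear terms cancel.\<close>
    moreover have "Re (z k - a) = Re (- (z k + a))" by (simp add: z_def)
    ultimately show "ln (norm (\<mu> (k + int d))) - ln (norm (\<mu> (- (k + int d))))
        = ln (norm (sinh (z k - a))) - ln (norm (sinh (z k + a)))"
      unfolding minus plus ln_norm_one_minus_exp[OF sinh1] ln_norm_one_minus_exp[OF sinh2]
      by simp
  qed
  also have "\<dots> = (\<Sum>k=-int p..int p. real n * ((1 / 4 + (of_int k + \<delta>) / real n) *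
      (ln (norm (sinh (z k - a))) - ln (norm (sinh (z k + a))))))"
  proof (intro sum.cong refl)
    fix k
    have "of_int (k + int d) = real n * (1 / 4 + (of_int k + \<delta>) / real n)"
      using n0 by (simp add: dn field_simps)
    thus "of_int (k + int d) * (ln (norm (sinh (z k - a))) - ln (norm (sinh (z k + a))))
      = real n * ((1 / 4 + (of_int k + \<delta>) / real n) *
      (ln (norm (sinh (z k - a))) - ln (norm (sinh (z k + a)))))"
      by (simp only: mult.assoc)
  qed
  finally show "ln (norm (Dq n q u)) / real n =
      (\<Sum>k=-int p..int p. (1 / 4 + (of_int k + \<delta>) / real n) *
      (ln (norm (sinh (z k - a))) - ln (norm (sinh (z k + a)))))"
    unfolding sum_distrib_left[symmetric] using n0 by simp
qed

subsection \<open>The limit\<close>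

text \<open>The two values of \<delta> handle both odd residue classes modulo 4 at once. The limit
  is taken for the logarithm, as regular plus singular part, and then exponentiated.\<close>

lemma Dq_root_tendsto:
  fixes A :: complex and \<delta> :: real and d :: "nat \<Rightarrow> nat"
  assumes A: "exp A \<noteq> -1"
    and d: "\<And>p. \<delta> = - 1 / 4 \<and> d p = p \<or> \<delta> = 1 / 4 \<and> d p = Suc p"
  defines "n \<equiv> \<lambda>p. 2 * (p + d p) + 1"
  defines "D \<equiv> \<lambda>p. Dq (n p) (exp (2 * of_real pi * \<i> / of_nat (n p)))
    (exp (2 * of_real pi * \<i> / of_nat (n p)) * exp (- (1 / of_nat (n p)) * A))"
  defines "w \<equiv> \<i> * A / (4 * of_real pi)"
  shows "(\<lambda>p. norm (D p) powr (1 / real (n p))) \<longlonglongrightarrow> 2 powr (- Im A / (4 * pi)) *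
    norm (sin (of_real pi * (of_real \<delta> + w)) / sin (of_real pi * (of_real \<delta> - w))) powr (1 / 4)"
proof -
  define X where "X = norm (sin (of_real pi * (of_real \<delta> + w)) / sin (of_real pi * (of_real \<delta> - w)))"
  define z where "z = (\<lambda>p k. \<i> * complex_of_real (2 * pi * (of_int k + \<delta>) / real (n p)))"
  define a where "a = (\<lambda>p. A / of_real (2 * real (n p)))"
  define R where "R = (\<lambda>s. ln (norm (complex_of_real s + w)) - ln (norm (of_real s - w)))"
  define E where "E = (\<lambda>v::complex. ln (norm (sinh v / v)))"
  define c where "c = (\<lambda>p k. 1 / 4 + (of_int k + \<delta>) / real (n p))"
  have n: "real (n p) = 4 * real p + 2 + 4 * \<delta>" for p
    using d[of p] by (auto simp: n_def)
  have n0: "real (n p) > 0" for p by (simp add: n_def)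
  have w_re: "Re w = - Im A / (4 * pi)"
    by (simp add: w_def Re_divide_of_real[of _ "4 * pi", simplified])
  have A_w: "A = - \<i> * (4 * of_real pi) * w"
    by (simp add: w_def)
  have \<delta>: "\<bar>\<delta>\<bar> \<le> 1 / 4" using d[of 0] by auto
  \<comment> \<open>The number \<open>s = k + \<delta>\<close> is an odd multiple of 1/4. If
    \<open>s\<close> were \<open>w\<close> or \<open>- w\<close>, then \<open>A\<close> would be
    \<open>- 4 pi i s\<close> or \<open>4 pi i s\<close>, contradicting
    \<open>exp A \<noteq> -1\<close>.\<close>
  have quarter: "exp (4 * of_real pi * \<i> * of_real (of_int k + \<delta>)) = -1" for k
  proof -
    have "exp (4 * of_real pi * \<i> * of_real (of_int k + \<delta>)) = exp (of_real pi * \<i>)"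
      unfolding exp_eq
    proof (cases "\<delta> = 1 / 4")
      case True
      show "\<exists>m::int. 4 * of_real pi * \<i> * of_real (of_int k + \<delta>)
          = of_real pi * \<i> + complex_of_real (of_int (2 * m) * pi) * \<i>"
        unfolding True by (intro exI[of _ "2 * k"]) (simp add: algebra_simps)
    next
      case False
      hence False: "\<delta> = - 1 / 4" using d[of 0] by auto
      show "\<exists>m::int. 4 * of_real pi * \<i> * of_real (of_int k + \<delta>)
          = of_real pi * \<i> + complex_of_real (of_int (2 * m) * pi) * \<i>"
        unfolding False by (intro exI[of _ "2 * k - 1"]) (simp add: algebra_simps)
    qed
    thus ?thesis by simp
  qed
  have nz1: "of_real (of_int k + \<delta>) \<noteq> w" for k
  proof
    assume "of_real (of_int k + \<delta>) = w"
    hence "A = - (4 * of_real pi * \<i> * of_real (of_int k + \<delta>))"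
      using A_w by simp
    hence "exp A = inverse (-1)" using quarter[of k] by (simp only: exp_minus)
    thus False using A by simp
  qed
  have nz2: "of_real (of_int k + \<delta>) \<noteq> - w" for k
  proof
    assume "of_real (of_int k + \<delta>) = - w"
    hence "A = 4 * of_real pi * \<i> * of_real (of_int k + \<delta>)"
      using A_w by simp
    thus False using A quarter[of k] by (simp only:)
  qed
  have sin_nz: "sin (of_real pi * (of_real \<delta> + v)) \<noteq> 0"
    if v: "\<And>k::int. of_real (of_int k + \<delta>) \<noteq> - v" for v :: complex
  proof
    assume "sin (of_real pi * (of_real \<delta> + v)) = 0"
    then obtain k :: int where "of_real pi * (of_real \<delta> + v) = of_real (of_int k * pi)"
      by (auto simp: sin_eq_0)
    hence "of_real pi * (of_real \<delta> + v) = of_real pi * (of_int k :: complex)" by simp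
    hence "of_real \<delta> + v = of_int k"
      by (subst (asm) mult_cancel_left) simp
    hence "of_real (of_int (- k) + \<delta>) = - v" by (simp add: algebra_simps add_eq_0_iff)
    thus False using v by blast
  qed
  have X: "X > 0"
    using sin_nz[of w] sin_nz[of "- w"] nz1 nz2 by (simp add: X_def)
  have split: "ln (norm (D p)) / real (n p)
      = (\<Sum>k=-int p..int p. c p k * (E (z p k - a p) - E (z p k + a p)))
        + (\<Sum>k=-int p..int p. c p k * R (of_int k + \<delta>))" for p
  proof -
    have "ln (norm (D p)) / real (n p) = (\<Sum>k=-int p..int p. c p k *
        (ln (norm (sinh (z p k - a p))) - ln (norm (sinh (z p k + a p)))))"
      using Dq_sinh_sum(4)[OF A d[of p]] by (simp only: D_def n_def c_def z_def a_def)
    also have "\<dots> = (\<Sum>k=-int p..int p. c p k * (E (z p k - a p) - E (z p k + a p))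
        + c p k * R (of_int k + \<delta>))"
    proof (intro sum.cong refl)
      fix k
      have "sinh (z p k - a p) \<noteq> 0" "sinh (z p k + a p) \<noteq> 0"
        using Dq_sinh_sum(1,2)[OF A d[of p], of k] by (simp_all only: n_def z_def a_def) auto
      hence nz: "sinh (z p k - a p) \<noteq> 0" "sinh (z p k + a p) \<noteq> 0"
        "z p k - a p \<noteq> 0" "z p k + a p \<noteq> 0"
        by auto
      \<comment> \<open>\<open>w\<close> is chosen so that \<open>z - a\<close> and
        \<open>z + a\<close> are \<open>s + w\<close> and \<open>s - w\<close> times this common
        factor, whose logarithm cancels in the difference.\<close>
      define e where "e = 2 * of_real pi * \<i> / complex_of_nat (n p)"
      have e: "e \<noteq> 0" using n0[of p] by (simp add: e_def)
      have "z p k - a p = e * (of_real (of_int k + \<delta>) + w)"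
        "z p k + a p = e * (of_real (of_int k + \<delta>) - w)"
        using n0[of p] by (simp_all add: z_def a_def e_def w_def field_simps)
      hence "ln (norm (z p k - a p)) - ln (norm (z p k + a p)) = R (of_int k + \<delta>)"
        using nz e by (simp add: R_def norm_mult ln_mult)
      moreover have "ln (norm (sinh (z p k - a p))) = E (z p k - a p) + ln (norm (z p k - a p))"
        "ln (norm (sinh (z p k + a p))) = E (z p k + a p) + ln (norm (z p k + a p))"
        using nz by (simp_all add: E_def norm_divide ln_div)
      ultimately show "c p k * (ln (norm (sinh (z p k - a p))) - ln (norm (sinh (z p k + a p))))
          = c p k * (E (z p k - a p) - E (z p k + a p)) + c p k * R (of_int k + \<delta>)"
        by (simp flip: distrib_left)
    qed
    finally show ?thesis by (simp only: sum.distrib)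
  qed
  have "(\<lambda>p. ln (norm (D p)) / real (n p))
      \<longlonglongrightarrow> Im A * (1 - ln 2) / (4 * pi) + (ln X / 4 + Re w)"
    unfolding split
  proof (rule tendsto_add)
    show "(\<lambda>p. \<Sum>k=-int p..int p. c p k * (E (z p k - a p) - E (z p k + a p)))
        \<longlonglongrightarrow> Im A * (1 - ln 2) / (4 * pi)"
      using regular_part_tendsto[OF \<delta>, of A] by (simp only: c_def E_def z_def a_def n)
    show "(\<lambda>p. \<Sum>k=-int p..int p. c p k * R (of_int k + \<delta>)) \<longlonglongrightarrow> ln X / 4 + Re w"
      using singular_part_tendsto[of \<delta> w, OF nz1 nz2] by (simp only: c_def R_def X_def n)
  qed
  hence "(\<lambda>p. exp (ln (norm (D p)) / real (n p)))
      \<longlonglongrightarrow> exp (Im A * (1 - ln 2) / (4 * pi) + (ln X / 4 + Re w))"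
    by (rule tendsto_exp)
  also have "(\<lambda>p. exp (ln (norm (D p)) / real (n p))) = (\<lambda>p. norm (D p) powr (1 / real (n p)))"
  proof
    fix p
    have "D p \<noteq> 0"
      using Dq_sinh_sum(3)[OF A d[of p]] by (simp only: D_def n_def) auto
    thus "exp (ln (norm (D p)) / real (n p)) = norm (D p) powr (1 / real (n p))"
      by (simp add: powr_def)
  qed
  \<comment> \<open>Since \<open>Re w = - Im A / (4 pi)\<close>, it cancels the part of the regular
    limit without \<open>ln 2\<close>.\<close>
  also have "exp (Im A * (1 - ln 2) / (4 * pi) + (ln X / 4 + Re w))
      = exp (- Im A / (4 * pi) * ln 2 + 1 / 4 * ln X)"
    unfolding w_re by (rule arg_cong[where f = exp]) (simp add: field_simps)
  also have "\<dots> = 2 powr (- Im A / (4 * pi)) * X powr (1 / 4)"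
    using X by (simp only: exp_add powr_def) simp
  finally show ?thesis unfolding X_def .
qed

lemma tendsto_sequentially_mod:
  assumes "(\<lambda>p. f (4 * p + r)) \<longlonglongrightarrow> l" and "r < 4"
  shows "(f \<longlongrightarrow> l) (sequentially_mod r 4)"
proof (rule topological_tendstoI)
  fix S assume "open S" "l \<in> S"
  hence "\<forall>\<^sub>F p in sequentially. f (4 * p + r) \<in> S"
    using assms(1) by (auto dest: topological_tendstoD)
  then obtain N where N: "\<And>p. p \<ge> N \<Longrightarrow> f (4 * p + r) \<in> S"
    by (auto simp: eventually_sequentially)
  have "f n \<in> S" if "n \<ge> 4 * N" "n mod 4 = r mod 4" for n
  proof -
    have "n = 4 * (n div 4) + r"
      using that(2) assms(2) by presburger
    moreover have "n div 4 \<ge> N" using that(1) by simp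
    ultimately show ?thesis using N by metis
  qed
  thus "\<forall>\<^sub>F n in sequentially_mod r 4. f n \<in> S"
    unfolding sequentially_mod_def eventually_inf_principal eventually_sequentially by auto
qed

theorem proposition18:
  fixes A :: complex and q u :: "nat \<Rightarrow> complex"
  assumes A: "exp A \<noteq> -1"
    and q: "\<And>n. odd n \<Longrightarrow> q n = exp (2 * of_real pi * \<i> / of_nat n)"
    and u: "\<And>n. odd n \<Longrightarrow> u n = q n * exp (- (1 / of_nat n) * A)"
  shows "((\<lambda>n. norm (Dq n (q n) (u n)) powr (1 / real n)) \<longlongrightarrow>
            2 powr (- Im A / (4 * pi)) *
            norm (cosh ((A - of_real pi * \<i>) / 4) / cosh ((A + of_real pi * \<i>) / 4)) powr (1 / 4))
           (sequentially_mod 1 4) \<and>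
         ((\<lambda>n. norm (Dq n (q n) (u n)) powr (1 / real n)) \<longlongrightarrow>
            2 powr (- Im A / (4 * pi)) *
            norm (sinh ((A - of_real pi * \<i>) / 4) / sinh ((A + of_real pi * \<i>) / 4)) powr (1 / 4))
           (sequentially_mod 3 4)"
proof
  define w where "w = \<i> * A / (4 * of_real pi)"
  define B where "B = \<i> * A / 4"
  have w: "of_real pi * w = B" by (simp add: w_def B_def)
  have arg: "\<i> * ((A - of_real pi * \<i>) / 4) = B + of_real pi / 4"
    "\<i> * ((A + of_real pi * \<i>) / 4) = B - of_real pi / 4"
    by (simp_all add: B_def field_simps)
  \<comment> \<open>The first two identities serve \<delta> = 1/4, the last two \<delta> = -1/4; the
    signs disappear under the norm.\<close>
  have sin1: "sin (B + of_real pi / 4) = sin (of_real pi * (of_real (1 / 4) + w))"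
    "sin (B - of_real pi / 4) = - sin (of_real pi * (of_real (1 / 4) - w))"
    "sin (B - of_real pi / 4) = sin (of_real pi * (of_real (- 1 / 4) + w))"
    "sin (B + of_real pi / 4) = - sin (of_real pi * (of_real (- 1 / 4) - w))"
    unfolding distrib_left right_diff_distrib w sin_minus[symmetric]
    by (rule arg_cong[where f = sin]; simp)+
  \<comment> \<open>The complement \<open>pi / 2 - x\<close> exchanges \<open>B + pi / 4\<close> and
    \<open>B - pi / 4\<close> up to sign, which matches the \<open>cosh\<close> quotient with
    \<delta> = -1/4.\<close>
  have cos1: "cos (B + of_real pi / 4) = - sin (B - of_real pi / 4)"
    "cos (B - of_real pi / 4) = sin (B + of_real pi / 4)"
    unfolding cos_sin_eq[of "B + of_real pi / 4"] cos_sin_eq[of "- (B - of_real pi / 4)", unfolded cos_minus]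
      sin_minus[symmetric]
    by (rule arg_cong[where f = sin]; simp add: field_simps)+
  show "((\<lambda>n. norm (Dq n (q n) (u n)) powr (1 / real n)) \<longlongrightarrow>
            2 powr (- Im A / (4 * pi)) *
            norm (cosh ((A - of_real pi * \<i>) / 4) / cosh ((A + of_real pi * \<i>) / 4)) powr (1 / 4))
           (sequentially_mod 1 4)"
  proof (rule tendsto_sequentially_mod)
    have eq: "norm (cosh ((A - of_real pi * \<i>) / 4) / cosh ((A + of_real pi * \<i>) / 4))
        = norm (sin (of_real pi * (of_real (- 1 / 4) + w)) / sin (of_real pi * (of_real (- 1 / 4) - w)))"
      unfolding cosh_conv_cos arg cos1 sin1(3,4) norm_divide norm_minus_cancel ..
    have n: "2 * (p + p) + 1 = 4 * p + 1" for p :: nat by simp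
    have odd: "odd (4 * p + 1)" for p :: nat by simp
    show "(\<lambda>p. norm (Dq (4 * p + 1) (q (4 * p + 1)) (u (4 * p + 1))) powr (1 / real (4 * p + 1)))
      \<longlonglongrightarrow> 2 powr (- Im A / (4 * pi)) *
            norm (cosh ((A - of_real pi * \<i>) / 4) / cosh ((A + of_real pi * \<i>) / 4)) powr (1 / 4)"
      using Dq_root_tendsto[OF A, of "- 1 / 4" "\<lambda>p. p"]
      unfolding eq u[OF odd] q[OF odd] n w_def by simp
  qed simp
  show "((\<lambda>n. norm (Dq n (q n) (u n)) powr (1 / real n)) \<longlongrightarrow>
            2 powr (- Im A / (4 * pi)) *
            norm (sinh ((A - of_real pi * \<i>) / 4) / sinh ((A + of_real pi * \<i>) / 4)) powr (1 / 4))
           (sequentially_mod 3 4)"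
  proof (rule tendsto_sequentially_mod)
    have eq: "norm (sinh ((A - of_real pi * \<i>) / 4) / sinh ((A + of_real pi * \<i>) / 4))
        = norm (sin (of_real pi * (of_real (1 / 4) + w)) / sin (of_real pi * (of_real (1 / 4) - w)))"
      unfolding sinh_conv_sin arg sin1(1,2) by (simp add: norm_divide norm_mult)
    have n: "2 * (p + Suc p) + 1 = 4 * p + 3" for p :: nat by simp
    have odd: "odd (4 * p + 3)" for p :: nat by simp
    show "(\<lambda>p. norm (Dq (4 * p + 3) (q (4 * p + 3)) (u (4 * p + 3))) powr (1 / real (4 * p + 3)))
      \<longlonglongrightarrow> 2 powr (- Im A / (4 * pi)) *
            norm (sinh ((A - of_real pi * \<i>) / 4) / sinh ((A + of_real pi * \<i>) / 4)) powr (1 / 4)"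
      using Dq_root_tendsto[OF A, of "1 / 4" Suc]
      unfolding eq u[OF odd] q[OF odd] n w_def by simp
  qed simp
qed

end
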